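(* Let $\mathbf g\in\mathcal H_{\mathbf r}$ and $\mathbf v\in\mathbb R^{n_1\times n_2\times\cdots\times n_d}$. The following are equivalent as $\Delta t\to0$ (i.e. each inequality is required for all sufficiently small $\Delta t>0$, with constants independent of $\Delta t$): (a) there exists $K\ge0$ such that $\left\|(\mathbf I-\mathcal P_{\mathbf g})\mathbf v\right\|_2\le K\Delta t$; (b) there exists $M\ge0$ such that $\left\|(\mathbf g+\Delta t\,\mathbf v)-\mathfrak T^{\rm best}_{\mathbf r}(\mathbf g+\Delta t\,\mathbf v)\right\|_2\le M\Delta t^2$; (c) there exists $C\ge0$ such that $\left\|(\mathbf g+\Delta t\,\mathbf v)-\mathfrak T^{\rm SVD}_{\mathbf r}(\mathbf g+\Delta t\,\mathbf v)\right\|_2\le C\Delta t^2$.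
   Context: Throughout, $d\ge2$ and $\|\cdot\|_2$ is the Euclidean (Frobenius) norm on $\mathbb R^{n_1\times\cdots\times n_d}$. Hierarchical Tucker manifold: fix a dimension tree $\mathcal T_d$ (binary tree with root $\{1,\dots,d\}$, leaves the singletons, every non-leaf node the disjoint union of its two children). For $\alpha\in\mathcal T_d$, $\mathbf f^{(\alpha)}$ is the matricization of $\mathbf f$ with rows indexed by the modes in $\alpha$ and columns by the others. For $\mathbf r=\{r_\alpha\}$, $\mathcal H_{\mathbf r}=\{\mathbf f:\operatorname{rank}\mathbf f^{(\alpha)}=r_\alpha\ \forall\alpha\}$, a smooth embedded submanifold of $\mathbb R^{n_1\times\cdots\times n_d}$, with closure $\overline{\mathcal H}_{\mathbf r}=\{\mathbf f:\operatorname{rank}\mathbf f^{(\alpha)}\le r_\alpha\ \forall\alpha\}$. $\mathcal P_{\mathbf g}$ is the orthogonal projection of $\mathbb R^{n_1\times\cdots\times n_d}$ onto the tangent space $T_{\mathbf g}\mathcal H_{\mathbf r}$, and $\mathbf I$ is the identity. Best truncation: $\mathfrak T^{\rm best}_{\mathbf r}(\mathbf f)\in\operatorname{argmin}_{\mathbf h\in\overline{\mathcal H}_{\mathbf r}}\|\mathbf f-\mathbf h\|_2$ (a fixed choice of minimizer). SVD truncation (HOSVD): $\mathfrak T^{\rm SVD}_{\mathbf r}(\mathbf f)=\prod_{\alpha\in\mathcal T_d^{\ell}}\mathbf P_\alpha\cdots\prod_{\alpha\in\mathcal T_d^{1}}\mathbf P_\alpha\,\mathbf f$, where $\mathcal T_d^1,\dots,\mathcal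 T_d^\ell$ are the layers of $\mathcal T_d$ (below the root, from top to bottom) and $\mathbf P_\alpha$ is the orthogonal projection acting on the $\alpha$-modes onto the span of $r_\alpha$ leading left singular vectors of $\mathbf f^{(\alpha)}$. It is known that $\|\mathbf f-\mathfrak T^{\rm best}_{\mathbf r}(\mathbf f)\|_2\le\|\mathbf f-\mathfrak T^{\rm SVD}_{\mathbf r}(\mathbf f)\|_2\le\sqrt{2d-3}\,\|\mathbf f-\mathfrak T^{\rm best}_{\mathbf r}(\mathbf f)\|_2$. *)

theory Defs
  imports "HOL-Analysis.Analysis"
begin

text \<open>
  Mode \<open>\<mu>\<close> has the index set \<open>N \<mu>\<close>, a subset of a common finite type, so that \<open>n\<^sub>\<mu> = card (N \<mu>)\<close>
  may differ from mode to mode. A multi-index over a set of modes \<open>\<alpha>\<close> is an element of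
  \<open>Pi\<^sub>E \<alpha> N\<close>. Vectors and matrices over such multi-indices are padded with zeros to
  vectors and matrices over the whole type \<open>'d \<Rightarrow> 'n\<close>; this changes neither norms and inner
  products nor ranks.
\<close>

definition tensors :: "('d::finite \<Rightarrow> 'n::finite set) \<Rightarrow> (real ^ ('d \<Rightarrow> 'n)) set" where
  "tensors N = {f. \<forall>i. i \<notin> Pi\<^sub>E UNIV N \<longrightarrow> f $ i = 0}"

definition matricization ::
  "('d::finite \<Rightarrow> 'n::finite set) \<Rightarrow> 'd set \<Rightarrow> real ^ ('d \<Rightarrow> 'n) \<Rightarrow> real ^ ('d \<Rightarrow> 'n) ^ ('d \<Rightarrow> 'n)" where
  "matricization N \<alpha> f =
    (\<chi> i j. if i \<in> Pi\<^sub>E \<alpha> N \<and> j \<in> Pi\<^sub>E (- \<alpha>) N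
           then f $ (\<lambda>\<mu>. if \<mu> \<in> \<alpha> then i \<mu> else j \<mu>) else 0)"

definition tensor_of_matrix ::
  "('d::finite \<Rightarrow> 'n::finite set) \<Rightarrow> 'd set \<Rightarrow> real ^ ('d \<Rightarrow> 'n) ^ ('d \<Rightarrow> 'n) \<Rightarrow> real ^ ('d \<Rightarrow> 'n)" where
  "tensor_of_matrix N \<alpha> A =
    (\<chi> i. if i \<in> Pi\<^sub>E UNIV N then A $ restrict i \<alpha> $ restrict i (- \<alpha>) else 0)"

definition mode_apply ::
  "('d::finite \<Rightarrow> 'n::finite set) \<Rightarrow> 'd set \<Rightarrow> real ^ ('d \<Rightarrow> 'n) ^ ('d \<Rightarrow> 'n)
    \<Rightarrow> real ^ ('d \<Rightarrow> 'n) \<Rightarrow> real ^ ('d \<Rightarrow> 'n)" where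
  "mode_apply N \<alpha> A f = tensor_of_matrix N \<alpha> (A ** matricization N \<alpha> f)"

lemma tensor_of_matricization:
  assumes "f \<in> tensors N"
  shows "tensor_of_matrix N \<alpha> (matricization N \<alpha> f) = f"
proof -
  have "tensor_of_matrix N \<alpha> (matricization N \<alpha> f) $ i = f $ i" for i
  proof (cases "i \<in> Pi\<^sub>E UNIV N")
    case True
    then have "restrict i \<alpha> \<in> Pi\<^sub>E \<alpha> N" "restrict i (- \<alpha>) \<in> Pi\<^sub>E (- \<alpha>) N"
      by auto
    moreover have "(\<lambda>\<mu>. if \<mu> \<in> \<alpha> then restrict i \<alpha> \<mu> else restrict i (- \<alpha>) \<mu>) = i"
      by (auto simp: fun_eq_iff)
    ultimately show ?thesis
      using True by (simp add: tensor_of_matrix_def matricization_def)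
  next
    case False
    then show ?thesis
      using assms by (simp add: tensor_of_matrix_def tensors_def)
  qed
  then show ?thesis
    by (simp add: vec_eq_iff)
qed

datatype 'd dtree = Leaf 'd | Node "'d dtree" "'d dtree"

fun modes :: "'d dtree \<Rightarrow> 'd set" where
  "modes (Leaf \<mu>) = {\<mu>}"
| "modes (Node s t) = modes s \<union> modes t"

fun disjoint_children :: "'d dtree \<Rightarrow> bool" where
  "disjoint_children (Leaf \<mu>) \<longleftrightarrow> True"
| "disjoint_children (Node s t) \<longleftrightarrow>
    modes s \<inter> modes t = {} \<and> disjoint_children s \<and> disjoint_children t"

definition dimension_tree :: "'d dtree \<Rightarrow> bool" where
  "dimension_tree t \<longleftrightarrow> modes t = UNIV \<and> disjoint_children t"

fun nodes :: "'d dtree \<Rightarrow> 'd set set" where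
  "nodes (Leaf \<mu>) = {{\<mu>}}"
| "nodes (Node s t) = insert (modes s \<union> modes t) (nodes s \<union> nodes t)"

fun depth :: "'d dtree \<Rightarrow> nat" where
  "depth (Leaf \<mu>) = 0"
| "depth (Node s t) = Suc (max (depth s) (depth t))"

text \<open>The nodes at distance \<open>k\<close> from the root.\<close>

fun layer :: "'d dtree \<Rightarrow> nat \<Rightarrow> 'd set list" where
  "layer t 0 = [modes t]"
| "layer (Leaf \<mu>) (Suc k) = []"
| "layer (Node s t) (Suc k) = layer s k @ layer t k"

definition ht_manifold ::
  "('d::finite \<Rightarrow> 'n::finite set) \<Rightarrow> 'd dtree \<Rightarrow> ('d set \<Rightarrow> nat) \<Rightarrow> (real ^ ('d \<Rightarrow> 'n)) set" where
  "ht_manifold N t r = {f \<in> tensors N. \<forall>\<alpha>\<in>nodes t. rank (matricization N \<alpha> f) = r \<alpha>}"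

text \<open>When \<open>ht_manifold N t r\<close> is nonempty, this rank-bounded set is its topological closure.\<close>

definition ht_closure ::
  "('d::finite \<Rightarrow> 'n::finite set) \<Rightarrow> 'd dtree \<Rightarrow> ('d set \<Rightarrow> nat) \<Rightarrow> (real ^ ('d \<Rightarrow> 'n)) set" where
  "ht_closure N t r = {f \<in> tensors N. \<forall>\<alpha>\<in>nodes t. rank (matricization N \<alpha> f) \<le> r \<alpha>}"

text \<open>\<open>D k\<close> is the \<open>k\<close>-th derivative of the curve.\<close>

definition smooth_curve_on :: "real set \<Rightarrow> (real \<Rightarrow> 'a::real_normed_vector) \<Rightarrow> bool" where
  "smooth_curve_on S c \<longleftrightarrow>
    (\<exists>D. D 0 = c \<and> (\<forall>k. \<forall>s\<in>S. (D k has_vector_derivative D (Suc k) s) (at s)))"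

definition tangent_space :: "'a::real_normed_vector set \<Rightarrow> 'a \<Rightarrow> 'a set" where
  "tangent_space M g =
    {w. \<exists>c \<epsilon>. 0 < \<epsilon> \<and> smooth_curve_on {-\<epsilon><..<\<epsilon>} c \<and> c ` {-\<epsilon><..<\<epsilon>} \<subseteq> M \<and>
          c 0 = g \<and> (c has_vector_derivative w) (at 0)}"

text \<open>Meaningful when \<open>S\<close> is a finite-dimensional subspace.\<close>

definition orth_proj :: "'a::real_inner set \<Rightarrow> 'a \<Rightarrow> 'a" where
  "orth_proj S v = (THE w. w \<in> S \<and> (\<forall>u\<in>S. orthogonal (v - w) u))"

definition is_best_truncation ::
  "('d::finite \<Rightarrow> 'n::finite set) \<Rightarrow> 'd dtree \<Rightarrow> ('d set \<Rightarrow> nat)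
    \<Rightarrow> real ^ ('d \<Rightarrow> 'n) \<Rightarrow> real ^ ('d \<Rightarrow> 'n) \<Rightarrow> bool" where
  "is_best_truncation N t r f h \<longleftrightarrow> is_arg_min (\<lambda>h. norm (f - h)) (\<lambda>h. h \<in> ht_closure N t r) h"

definition orthonormal_vectors :: "'m::finite set \<Rightarrow> (nat \<Rightarrow> real ^ 'm) \<Rightarrow> bool" where
  "orthonormal_vectors R u \<longleftrightarrow>
    (\<forall>k<card R. \<forall>i. i \<notin> R \<longrightarrow> u k $ i = 0) \<and>
    (\<forall>k<card R. \<forall>l<card R. u k \<bullet> u l = (if k = l then 1 else 0))"

text \<open>
  Full singular value decomposition of a matrix whose rows are indexed by \<open>R\<close> and whose columns
  are indexed by \<open>C\<close>: \<open>u\<close> and \<open>w\<close> are orthonormal bases of the two coordinate spaces.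
\<close>

definition is_svd ::
  "'m::finite set \<Rightarrow> 'c::finite set \<Rightarrow> real ^ 'c ^ 'm
    \<Rightarrow> (nat \<Rightarrow> real) \<Rightarrow> (nat \<Rightarrow> real ^ 'm) \<Rightarrow> (nat \<Rightarrow> real ^ 'c) \<Rightarrow> bool" where
  "is_svd R C A \<sigma> u w \<longleftrightarrow>
    orthonormal_vectors R u \<and> orthonormal_vectors C w \<and>
    (\<forall>k<min (card R) (card C). 0 \<le> \<sigma> k) \<and>
    (\<forall>k l. k \<le> l \<and> l < min (card R) (card C) \<longrightarrow> \<sigma> l \<le> \<sigma> k) \<and>
    A = (\<chi> i j. \<Sum>k<min (card R) (card C). \<sigma> k * u k $ i * w k $ j)"

text \<open>
  \<open>P\<close> projects onto the span of \<open>q\<close> leading left singular vectors of \<open>A\<close>. Since singular vectors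
  are not unique, this is a relation. It is only meaningful for \<open>q \<le> card R\<close>.
\<close>

definition is_leading_projection ::
  "'m::finite set \<Rightarrow> 'c::finite set \<Rightarrow> real ^ 'c ^ 'm \<Rightarrow> nat \<Rightarrow> real ^ 'm ^ 'm \<Rightarrow> bool" where
  "is_leading_projection R C A q P \<longleftrightarrow>
    (\<exists>\<sigma> u w. is_svd R C A \<sigma> u w \<and> P = matrix (orth_proj (span (u ` {..<q}))))"

text \<open>
  All projections are computed from the original tensor \<open>f\<close>. The layers are processed from the
  children of the root downwards; the order within a layer is immaterial, since the nodes of
  a layer are disjoint.
\<close>

definition is_svd_truncation ::
  "('d::finite \<Rightarrow> 'n::finite set) \<Rightarrow> 'd dtree \<Rightarrow> ('d set \<Rightarrow> nat)
    \<Rightarrow> real ^ ('d \<Rightarrow> 'n) \<Rightarrow> real ^ ('d \<Rightarrow> 'n) \<Rightarrow> bool" where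
  "is_svd_truncation N t r f h \<longleftrightarrow>
    (\<exists>P. (\<forall>\<alpha>\<in>nodes t - {UNIV}.
            is_leading_projection (Pi\<^sub>E \<alpha> N) (Pi\<^sub>E (- \<alpha>) N) (matricization N \<alpha> f) (r \<alpha>) (P \<alpha>)) \<and>
         h = fold (\<lambda>k. fold (\<lambda>\<alpha>. mode_apply N \<alpha> (P \<alpha>)) (layer t k)) [1..<Suc (depth t)] f)"

end

theory Submission
  imports Defs
begin

text \<open>
  All three conditions say that \<open>v\<close> is tangent to the manifold at \<open>g\<close>. For the first one this is
  immediate once the tangent space is known to be a subspace, because the norm in it does not
  depend on the step size.

  The tangent space is identified with the space \<open>ht_linearized\<close> of tensors \<open>v\<close> whose
  matricization at each node has the form \<open>B ** G + G ** C\<close>, where \<open>G\<close> is the matricization of \<open>g\<close>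
  (\<open>tangent_space_ht_manifold\<close>). One inclusion is a statement on matrices: a curve through \<open>G\<close> of
  rank at most \<open>rank G\<close> has a velocity of this form (\<open>velocity_of_bounded_rank_curve\<close>, which rests on
  the semicontinuity of the rank). For the other inclusion the conditions at the different nodes
  have to be satisfied by one curve. To this end, \<open>g + s *\<^sub>R v\<close> is multiplied, from the root of the
  tree downwards, by matrices \<open>P \<alpha> + s *\<^sub>R Q \<alpha>\<close> of rank at most \<open>r \<alpha>\<close> each of which fixes
  \<open>g + s *\<^sub>R v\<close> up to second order. As later factors do not increase the ranks achieved by
  earlier ones, the product is a curve on the manifold near \<open>s = 0\<close>, polynomial in \<open>s\<close>, of the form
  \<open>g + s *\<^sub>R v + s\<^sup>2 *\<^sub>R q s\<close> (\<open>ht_linearized_second_order_curve\<close>).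

  Any truncation \<open>T\<close> into the rank-bounded set whose error is at most a constant times the
  smallest possible error is then of second order along \<open>g + s *\<^sub>R v\<close> if and only if \<open>v\<close> is tangent
  (\<open>second_order_approximation_iff\<close>): the curve above is a competitor at distance of order \<open>s\<^sup>2\<close>,
  and conversely the truncated points themselves have right-sided velocity \<open>v\<close>. The best truncation
  is of this kind with constant \<open>1\<close>, the SVD truncation by \<open>svd_truncation_in_closure\<close> and
  \<open>svd_truncation_quasi_optimal\<close>.
\<close>

section \<open>Generalized inverses and perturbation of rank\<close>

text \<open>
  A generalized inverse replaces orthonormal bases in the rank arguments: \<open>G ** Y\<close> is an
  idempotent onto the column space of \<open>G\<close>, and \<open>mat 1 - Y ** G\<close> is an idempotent onto its kernel.
\<close>

lemma generalized_inverse_exists: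
  fixes G :: "real^'n^'m"
  obtains Y :: "real^'m^'n" where "G ** Y ** G = G"
proof -
  obtain h where h: "linear h" "\<And>x. G *v (h (G *v x)) = G *v x"
    using linear_exists_right_inverse_on[OF matrix_vector_mul_linear[of G] subspace_UNIV] by blast
  have "(G ** matrix h ** G) *v x = G *v x" for x
    by (simp add: matrix_vector_mul_assoc[symmetric] matrix_works h)
  then have "G ** matrix h ** G = G"
    by (simp add: matrix_eq)
  then show ?thesis by (rule that)
qed

interpretation matrix_mult: bounded_bilinear
  "(**) :: real^'n^'m \<Rightarrow> real^'p^'n \<Rightarrow> real^'p^'m"
  unfolding bilinear_conv_bounded_bilinear[symmetric] bilinear_def
  by (auto intro!: linearI simp: vec_eq_iff matrix_matrix_mult_def algebra_simps sum.distrib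
      sum_distrib_left)

interpretation matrix_vector_mult: bounded_bilinear
  "(*v) :: real^'n^'m \<Rightarrow> real^'n \<Rightarrow> real^'m"
  unfolding bilinear_conv_bounded_bilinear[symmetric] bilinear_def
  by (auto intro!: linearI simp: algebra_simps scaleR_matrix_vector_assoc)

lemma rank_plus_le:
  fixes A B :: "real^'n^'m"
  shows "rank (A + B) \<le> rank A + rank B"
proof -
  have "range ((*v) (A + B)) \<subseteq> {x + y | x y. x \<in> range ((*v) A) \<and> y \<in> range ((*v) B)}"
    by (auto simp: matrix_vector_mult_add_rdistrib)
  then have "rank (A + B) \<le> dim {x + y | x y. x \<in> range ((*v) A) \<and> y \<in> range ((*v) B)}"
    unfolding rank_dim_range by (rule dim_subset)
  also have "\<dots> \<le> rank A + rank B"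
    unfolding rank_dim_range
    using dim_sums_Int[of "range ((*v) A)" "range ((*v) B)"]
      linear_subspace_image[OF matrix_vector_mul_linear subspace_UNIV, of A]
      linear_subspace_image[OF matrix_vector_mul_linear subspace_UNIV, of B] by linarith
  finally show ?thesis .
qed

lemma rank_complement_idempotent_le:
  fixes E :: "real^'n^'n"
  assumes "E ** E = E"
  shows "rank (mat 1 - E) + rank E \<le> CARD('n)"
proof -
  let ?R = "range ((*v) (mat 1 - E))" and ?S = "range ((*v) E)"
  have *: "E *v (x - E *v x) = 0" for x
    by (simp add: matrix_vector_mult_diff_distrib matrix_vector_mul_assoc assms)
  have "?R \<inter> ?S \<subseteq> {0}"
  proof
    fix y assume "y \<in> ?R \<inter> ?S"
    then obtain x z where "y = x - E *v x" "y = E *v z"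
      by (metis IntE matrix_vector_mul_lid matrix_vector_mult_diff_rdistrib rangeE)
    have "E *v (E *v z) = E *v z"
      by (simp add: matrix_vector_mul_assoc assms)
    then have "y = E *v y"
      using \<open>y = E *v z\<close> by simp
    also have "\<dots> = 0" using * \<open>y = x - E *v x\<close> by simp
    finally show "y \<in> {0}" by simp
  qed
  then have "dim (?R \<inter> ?S) = 0" by simp
  moreover have "dim {x + y | x y. x \<in> ?R \<and> y \<in> ?S} \<le> CARD('n)"
    by (rule order_trans[OF dim_subset_UNIV]) simp
  ultimately show ?thesis
    unfolding rank_dim_range
    using dim_sums_Int[of ?R ?S]
      linear_subspace_image[OF matrix_vector_mul_linear subspace_UNIV, of "mat 1 - E"]
      linear_subspace_image[OF matrix_vector_mul_linear subspace_UNIV, of E] by linarith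
qed

text \<open>
  With a generalized inverse \<open>Y\<close> of the limit \<open>L\<close>, the matrices \<open>A x ** Y + (mat 1 - L ** Y)\<close> tend
  to the identity, hence have full rank eventually. The second summand has rank at most
  \<open>CARD('m) - rank L\<close>, so the first must contribute at least \<open>rank L\<close>.
\<close>

lemma rank_lower_semicontinuous:
  fixes A :: "'b \<Rightarrow> real^'n^'m"
  assumes "(A \<longlongrightarrow> L) F"
  shows "\<forall>\<^sub>F x in F. rank L \<le> rank (A x)"
proof -
  obtain Y :: "real^'m^'n" where Y: "L ** Y ** L = L"
    by (rule generalized_inverse_exists)
  define E where "E = L ** Y"
  have E: "E ** E = E" "E ** L = L"
    using Y by (simp_all add: E_def matrix_mul_assoc)
  have "rank L \<le> rank E"
    using rank_mul_le_left[of E L] E by simp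
  then have comp: "rank (mat 1 - E) + rank L \<le> CARD('m)"
    using rank_complement_idempotent_le[OF E(1)] by simp
  have "((\<lambda>x. A x ** Y + (mat 1 - E)) \<longlongrightarrow> L ** Y + (mat 1 - E)) F"
    by (intro tendsto_add tendsto_const matrix_mult.tendsto assms)
  then have "((\<lambda>x. A x ** Y + (mat 1 - E)) \<longlongrightarrow> mat 1) F"
    by (simp add: E_def)
  then have "((\<lambda>x. det (A x ** Y + (mat 1 - E))) \<longlongrightarrow> det (mat 1 :: real^'m^'m)) F"
    unfolding det_def by (intro tendsto_intros)
  then have "\<forall>\<^sub>F x in F. det (A x ** Y + (mat 1 - E)) \<noteq> 0"
    by (rule tendsto_imp_eventually_ne) simp
  then show ?thesis
  proof eventually_elim
    case (elim x)
    then have "CARD('m) \<le> rank (A x ** Y + (mat 1 - E))"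
      using det_eq_0_rank[of "A x ** Y + (mat 1 - E)"] by linarith
    also have "\<dots> \<le> rank (A x) + rank (mat 1 - E)"
      using rank_plus_le[of "A x ** Y" "mat 1 - E"] rank_mul_le_left[of "A x" Y] by linarith
    finally show ?case using comp by linarith
  qed
qed

text \<open>
  The velocities \<open>B ** G + G ** C\<close> form the tangent space at \<open>G\<close> of the matrices of rank \<open>rank G\<close>.
  The lemma covers curves that are only known to be differentiable from the right and to have rank
  at most \<open>rank G\<close>. Stretching the kernel directions of \<open>G\<close> by \<open>1 / s\<close> does not increase the rank of
  \<open>H s\<close>, and the stretched matrices converge to \<open>G + V ** K\<close>, where \<open>K\<close> projects onto the kernel.
  By semicontinuity that limit has rank at most \<open>rank G\<close>, while its range contains that of \<open>G\<close>; hence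
  \<open>V\<close> maps the kernel of \<open>G\<close> into the range of \<open>G\<close>.
\<close>

lemma velocity_of_bounded_rank_curve:
  fixes G V :: "real^'n^'m" and H :: "real \<Rightarrow> real^'n^'m"
  assumes lim: "((\<lambda>s. (1 / s) *\<^sub>R (H s - G)) \<longlongrightarrow> V) (at_right 0)"
    and rk: "\<forall>\<^sub>F s in at_right 0. rank (H s) \<le> rank G"
  shows "\<exists>B C. V = B ** G + G ** C"
proof -
  obtain Y :: "real^'m^'n" where Y: "G ** Y ** G = G"
    by (rule generalized_inverse_exists)
  define K where "K = mat 1 - Y ** G"
  have GK: "G ** K = 0"
    by (simp add: K_def matrix_mult.diff_right matrix_mul_assoc Y)
  have KYG: "K ** Y ** G = 0"
    by (simp add: K_def matrix_mult.diff_left Y flip: matrix_mul_assoc)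
      (metis Y matrix_mul_assoc)
  define Q where "Q s = (1 / s) *\<^sub>R (H s - G)" for s
  define M where "M = G + V ** K"
  \<comment> \<open>As \<open>G ** K = 0\<close>, the factor \<open>1 / s\<close> only meets the difference quotient \<open>Q s\<close>.\<close>
  have ident: "G + s *\<^sub>R (Q s ** (mat 1 - K)) + Q s ** K = H s ** ((mat 1 - K) + (1 / s) *\<^sub>R K)"
    if "s \<noteq> 0" for s
  proof -
    have H: "H s = G + s *\<^sub>R Q s" using that by (simp add: Q_def)
    show ?thesis unfolding H using GK that
      by (simp add: matrix_mult.add_right matrix_mult.add_left matrix_mult.diff_right 
         matrix_mult.scaleR_left matrix_mult.scaleR_right scaleR_diff_right)
  qed
  have id: "((\<lambda>s. s) \<longlongrightarrow> (0::real)) (at_right 0)"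
    by (rule tendsto_ident_at)
  have "((\<lambda>s. G + s *\<^sub>R (Q s ** (mat 1 - K)) + Q s ** K)
      \<longlongrightarrow> G + 0 *\<^sub>R (V ** (mat 1 - K)) + V ** K) (at_right 0)"
    using lim unfolding Q_def[symmetric]
    by (intro tendsto_add tendsto_const tendsto_scaleR id matrix_mult.tendsto)
  then have "((\<lambda>s. G + s *\<^sub>R (Q s ** (mat 1 - K)) + Q s ** K) \<longlongrightarrow> M) (at_right 0)"
    by (simp add: M_def)
  from rank_lower_semicontinuous[OF this]
  have "\<forall>\<^sub>F s in at_right (0::real). rank M \<le> rank G"
    using rk eventually_at_right_less[of "0::real"]
  proof eventually_elim
    case (elim s)
    then show ?case
      using ident[of s] rank_mul_le_left[of "H s" "(mat 1 - K) + (1 / s) *\<^sub>R K"] by simp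
  qed
  then have rM: "rank M \<le> rank G" by simp
  have MYG: "M ** (Y ** G) = G"
    by (simp add: M_def matrix_mult.add_left matrix_mul_assoc Y)
      (metis KYG matrix_mul_assoc matrix_mult.zero_right)
  have "range ((*v) G) \<subseteq> range ((*v) M)"
    by (metis (no_types, lifting) MYG image_subsetI matrix_vector_mul_assoc rangeI)
  then have "range ((*v) G) = range ((*v) M)"
    using rM unfolding rank_dim_range
    by (intro subspace_dim_equal)
      (auto intro!: linear_subspace_image matrix_vector_mul_linear)
  have "(V ** K) *v x = (G ** Y ** (V ** K)) *v x" for x
  proof -
    have "(V ** K) *v x = M *v x - G *v x"
      by (simp add: M_def matrix_vector_mult_add_rdistrib)
    moreover obtain z where "M *v x = G *v z"
      using \<open>range ((*v) G) = range ((*v) M)\<close> by (metis rangeE rangeI)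
    ultimately have VK: "(V ** K) *v x = G *v (z - x)"
      by (simp add: matrix_vector_mult_diff_distrib)
    show ?thesis
      by (metis VK Y matrix_vector_mul_assoc)
  qed
  then have VK: "V ** K = G ** Y ** (V ** K)"
    by (simp add: matrix_eq)
  \<comment> \<open>The first part has \<open>G\<close> as its right factor; the second, which lives on the kernel of \<open>G\<close>, has \<open>G\<close>
    as its left factor.\<close>
  have "V = (V ** Y) ** G + V ** K"
    by (simp add: K_def matrix_mult.diff_right matrix_mul_assoc)
  also have "V ** K = G ** (Y ** (V ** K))"
    by (metis VK matrix_mul_assoc)
  finally show ?thesis by blast
qed

section \<open>Orthogonal projections and truncated singular value decompositions\<close>

lemma orth_proj_eqI:
  fixes S :: "'a::euclidean_space set"
  assumes "subspace S" "w \<in> S" "\<And>u. u \<in> S \<Longrightarrow> orthogonal (v - w) u"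
  shows "orth_proj S v = w"
  unfolding orth_proj_def
proof (rule the_equality)
  fix w' assume w': "w' \<in> S \<and> (\<forall>u\<in>S. orthogonal (v - w') u)"
  then have d: "w' - w \<in> S" using assms by (simp add: subspace_diff)
  have "(v - w) \<bullet> (w' - w) = 0" "(v - w') \<bullet> (w' - w) = 0"
    using d assms w' by (auto simp: orthogonal_def)
  then have "(w' - w) \<bullet> (w' - w) = 0"
    by (simp add: inner_diff_left)
  then show "w' = w" by simp
qed (use assms in auto)

lemma
  fixes S :: "'a::euclidean_space set"
  assumes "subspace S"
  shows orth_proj_in: "orth_proj S v \<in> S"
    and orth_proj_orthogonal: "u \<in> S \<Longrightarrow> (v - orth_proj S v) \<bullet> u = 0"
proof -
  obtain y z where yz: "y \<in> span S" "\<And>w. w \<in> span S \<Longrightarrow> orthogonal z w" "v = y + z"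
    using orthogonal_subspace_decomp_exists by blast
  have S: "span S = S" using assms by simp
  have eq: "orth_proj S v = y"
    using yz S by (intro orth_proj_eqI[OF assms]) auto
  show "orth_proj S v \<in> S" using eq yz S by simp
  show "u \<in> S \<Longrightarrow> (v - orth_proj S v) \<bullet> u = 0"
    using eq yz S by (simp add: orthogonal_def)
qed

lemma orth_proj_id:
  fixes S :: "'a::euclidean_space set"
  assumes "subspace S" "v \<in> S"
  shows "orth_proj S v = v"
  using assms by (intro orth_proj_eqI) (auto simp: orthogonal_def)

lemma linear_orth_proj:
  fixes S :: "'a::euclidean_space set"
  assumes S: "subspace S"
  shows "linear (orth_proj S)"
proof (rule linearI)
  have inner: "orth_proj S x \<bullet> u = x \<bullet> u" if "u \<in> S" for x u
    using orth_proj_orthogonal[OF S that, of x] by (simp add: inner_diff_left)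
  show "orth_proj S (x + y) = orth_proj S x + orth_proj S y" for x y
    using orth_proj_in[OF S] S
    by (intro orth_proj_eqI)
       (auto simp: subspace_add orthogonal_def inner_diff_left inner_add_left inner)
  show "orth_proj S (c *\<^sub>R x) = c *\<^sub>R orth_proj S x" for c x
    using orth_proj_in[OF S] S
    by (intro orth_proj_eqI)
       (auto simp: subspace_scale orthogonal_def inner_diff_left inner)
qed

lemma norm_orth_proj_le:
  fixes S :: "'a::euclidean_space set"
  assumes S: "subspace S"
  shows "norm (orth_proj S v) \<le> norm v"
proof -
  have "orthogonal (orth_proj S v) (v - orth_proj S v)"
    using orth_proj_orthogonal[OF S orth_proj_in[OF S]] by (simp add: orthogonal_def inner_commute)
  from norm_add_Pythagorean[OF this]
  have "(norm (orth_proj S v))\<^sup>2 \<le> (norm v)\<^sup>2" by simp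
  then show ?thesis by (rule power2_le_imp_le) simp
qed

lemma norm_matrix_squared_columns:
  fixes A :: "real^'n^'m"
  shows "(norm A)\<^sup>2 = (\<Sum>j\<in>UNIV. (norm (column j A))\<^sup>2)"
proof -
  have "(norm A)\<^sup>2 = (\<Sum>i\<in>UNIV. \<Sum>j\<in>UNIV. (A $ i $ j)\<^sup>2)"
    unfolding power2_norm_eq_inner inner_vec_def by (simp add: power2_eq_square)
  also have "\<dots> = (\<Sum>j\<in>UNIV. (norm (column j A))\<^sup>2)"
    unfolding power2_norm_eq_inner inner_vec_def
    by (subst sum.swap) (simp add: power2_eq_square column_def)
  finally show ?thesis .
qed

lemma column_matrix_mult: "column j (A ** B) = A *v column j B"
  by (simp add: column_def matrix_matrix_mult_def matrix_vector_mult_def vec_eq_iff)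

lemma norm_orth_proj_matrix_mult_le:
  fixes A :: "real^'n^'m"
  assumes "subspace S"
  shows "norm (matrix (orth_proj S) ** A) \<le> norm A"
proof -
  have "(norm (matrix (orth_proj S) ** A))\<^sup>2 \<le> (norm A)\<^sup>2"
    unfolding norm_matrix_squared_columns
    by (intro sum_mono power_mono)
      (simp_all add: column_matrix_mult matrix_works linear_orth_proj assms norm_orth_proj_le)
  then show ?thesis by (rule power2_le_imp_le) simp
qed

lemma rank_orth_proj:
  fixes S :: "(real^'m) set"
  assumes "subspace S"
  shows "rank (matrix (orth_proj S)) = dim S"
proof -
  have "range (orth_proj S) = S"
    using orth_proj_in[OF assms] orth_proj_id[OF assms] by (metis image_subset_iff rangeI subsetI subset_antisym)
  then show ?thesis
    by (simp add: rank_dim_range matrix_works linear_orth_proj assms)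
qed

lemma rank_leading_projection_le:
  assumes "is_leading_projection R C A q P"
  shows "rank P \<le> q"
proof -
  obtain u where P: "P = matrix (orth_proj (span (u ` {..<q})))"
    using assms by (auto simp: is_leading_projection_def)
  have "rank P = dim (u ` {..<q})"
    unfolding P by (simp add: rank_orth_proj)
  also have "\<dots> \<le> card (u ` {..<q})" by (intro dim_le_card') simp
  also have "\<dots> \<le> q" using card_image_le[of "{..<q}" u] by simp
  finally show ?thesis .
qed

lemma norm_leading_projection_mult_le:
  assumes "is_leading_projection R C A q P"
  shows "norm (P ** B) \<le> norm B"
  using assms norm_orth_proj_matrix_mult_le[OF subspace_span]
  by (auto simp: is_leading_projection_def)

definition outer_product :: "real^'m \<Rightarrow> real^'n \<Rightarrow> real^'n^'m" where
  "outer_product x y = (\<chi> i j. x $ i * y $ j)"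

lemma matrix_mult_outer: "A ** outer_product x y = outer_product (A *v x) y"
  by (simp add: outer_product_def matrix_matrix_mult_def matrix_vector_mult_def vec_eq_iff
      sum_distrib_right mult.assoc)

lemma outer_mult_vec: "outer_product x y *v z = (y \<bullet> z) *\<^sub>R x"
  by (simp add: outer_product_def matrix_vector_mult_def vec_eq_iff inner_vec_def sum_distrib_left
      mult_ac)

lemma norm_outer: "norm (outer_product x y) = norm x * norm y"
proof -
  have "(norm (outer_product x y))\<^sup>2 = (norm x * norm y)\<^sup>2"
    unfolding power_mult_distrib power2_norm_eq_inner inner_vec_def outer_product_def sum_product
    by (simp add: mult_ac)
  then show ?thesis by (simp add: power2_eq_iff_nonneg)
qed

lemma norm_matrix_vector_mult_le:
  fixes A :: "real^'n^'m"
  shows "norm (A *v x) \<le> norm A * norm x"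
proof -
  have "(norm (A *v x))\<^sup>2 \<le> (\<Sum>i\<in>UNIV. (norm (A $ i))\<^sup>2 * (norm x)\<^sup>2)"
    unfolding power2_norm_eq_inner inner_vec_def[of "A *v x"]
  proof (rule sum_mono)
    fix i
    have "(A *v x) $ i = A $ i \<bullet> x" by (simp add: matrix_vector_mul_component)
    then show "(A *v x) $ i \<bullet> (A *v x) $ i \<le> (A $ i \<bullet> A $ i) * (x \<bullet> x)"
      using Cauchy_Schwarz_ineq[of "A $ i" x] by (simp add: power2_eq_square)
  qed
  also have "\<dots> = (norm A * norm x)\<^sup>2"
    by (simp add: power_mult_distrib power2_norm_eq_inner inner_vec_def[of A] sum_distrib_right)
  finally show ?thesis by (rule power2_le_imp_le) simp
qed

lemma kernel_vector_in_large_subspace: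
  fixes H :: "real^'n^'m"
  assumes "rank H < dim S" "subspace S"
  obtains x where "x \<in> S" "x \<noteq> 0" "H *v x = 0"
proof -
  have "\<not> inj_on ((*v) H) (span S)"
  proof
    assume "inj_on ((*v) H) (span S)"
    then have "dim ((*v) H ` S) = dim S"
      by (intro dim_image_eq matrix_vector_mul_linear)
    moreover have "dim ((*v) H ` S) \<le> rank H"
      unfolding rank_dim_range by (intro dim_subset) auto
    ultimately show False using assms by simp
  qed
  then obtain a b where "a \<in> S" "b \<in> S" "a \<noteq> b" "H *v a = H *v b"
    unfolding span_eq_iff[THEN iffD2, OF assms(2)] inj_on_def by blast
  then show ?thesis
    using that[of "a - b"] assms by (simp add: subspace_diff matrix_vector_mult_diff_distrib)
qed

text \<open>
  A quasi-optimal form of the Eckart--Young theorem. The error is the tail of the decomposition and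
  is governed by its largest singular value \<open>\<sigma> q\<close>. A matrix \<open>H\<close> of rank at most \<open>q\<close> annihilates some
  nonzero \<open>x\<close> in the span of the \<open>q + 1\<close> leading right singular vectors; there
  \<open>\<sigma> q * norm x \<le> norm (A *v x) = norm ((A - H) *v x)\<close>, so \<open>\<sigma> q \<le> norm (A - H)\<close>.
\<close>

lemma leading_projection_quasi_optimal:
  fixes A H :: "real^'c^'m"
  assumes P: "is_leading_projection R C A q P" and H: "rank H \<le> q"
  shows "norm (A - P ** A) \<le> real CARD('m) * norm (A - H)"
proof -
  obtain \<sigma> u w where svd: "is_svd R C A \<sigma> u w" and P: "P = matrix (orth_proj (span (u ` {..<q})))"
    using P by (auto simp: is_leading_projection_def)
  define m where "m = min (card R) (card C)"
  have u: "u k \<bullet> u l = (if k = l then 1 else 0)" if "k < m" "l < m" for k l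
    using svd that by (auto simp: is_svd_def orthonormal_vectors_def m_def)
  have w: "w k \<bullet> w l = (if k = l then 1 else 0)" if "k < m" "l < m" for k l
    using svd that by (auto simp: is_svd_def orthonormal_vectors_def m_def)
  have pos: "0 \<le> \<sigma> k" if "k < m" for k
    using svd that by (auto simp: is_svd_def m_def)
  have decr: "\<sigma> l \<le> \<sigma> k" if "k \<le> l" "l < m" for k l
    using svd that by (auto simp: is_svd_def m_def)
  have A: "A = (\<Sum>k<m. \<sigma> k *\<^sub>R outer_product (u k) (w k))"
    using svd by (simp add: is_svd_def m_def[symmetric] vec_eq_iff outer_product_def mult.assoc)
  have nu: "norm (u k) = 1" "norm (w k) = 1" if "k < m" for k
    using u[OF that that] w[OF that that] by (simp_all add: norm_eq_sqrt_inner)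
  have m_le: "m \<le> CARD('m)"
    using card_mono[of UNIV R] by (simp add: m_def)
  have Pu: "P *v u k = (if k < q then u k else 0)" if "k < m" for k
  proof (cases "k < q")
    case True
    then show ?thesis
      unfolding P by (simp add: matrix_works linear_orth_proj orth_proj_id span_base)
  next
    case False
    have "orthogonal (u k) x" if "x \<in> span (u ` {..<q})" for x
      using that
    proof (rule orthogonal_to_span)
      show "orthogonal (u k) y" if "y \<in> u ` {..<q}" for y
        using that False \<open>k < m\<close> u by (auto simp: orthogonal_def)
    qed
    then have "orth_proj (span (u ` {..<q})) (u k) = 0"
      by (intro orth_proj_eqI) (auto simp: span_zero)
    then show ?thesis
      using False unfolding P by (simp add: matrix_works linear_orth_proj)
  qed
  have "P ** A = (\<Sum>k<m. \<sigma> k *\<^sub>R outer_product (P *v u k) (w k))"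
    by (subst A) (simp add: matrix_mult.sum_right matrix_mult.scaleR_right matrix_mult_outer)
  then have "A - P ** A = (\<Sum>k<m. \<sigma> k *\<^sub>R (outer_product (u k) (w k) - outer_product (P *v u k) (w k)))"
    by (subst A) (simp add: sum_subtractf scaleR_diff_right)
  also have "norm \<dots> \<le> (\<Sum>k<m. norm (A - H))"
  proof (rule sum_norm_le)
    fix k assume "k \<in> {..<m}"
    then have k: "k < m" by simp
    show "norm (\<sigma> k *\<^sub>R (outer_product (u k) (w k) - outer_product (P *v u k) (w k))) \<le> norm (A - H)"
    proof (cases "k < q")
      case True
      then show ?thesis using Pu[OF k] by simp
    next
      case False
      then have q: "q < m" using k by simp
      have inj: "inj_on w {..q}"
        using w q by (intro inj_onI) (metis atMost_iff le_less_trans zero_neq_one)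
      have "pairwise orthogonal (w ` {..q})"
        using w q by (auto simp: pairwise_def orthogonal_def)
      moreover have "0 \<notin> w ` {..q}"
        using nu(2) q by (metis atMost_iff imageE le_less_trans norm_zero zero_neq_one)
      ultimately have "independent (w ` {..q})"
        by (rule pairwise_orthogonal_independent)
      then have "dim (span (w ` {..q})) = Suc q"
        using inj by (simp add: dim_eq_card_independent card_image)
      then obtain x where x: "x \<in> span (w ` {..q})" "x \<noteq> 0" "H *v x = 0"
        using kernel_vector_in_large_subspace[of H "span (w ` {..q})"] H by auto
      have Ax: "A *v x = (\<Sum>k<m. (\<sigma> k * (w k \<bullet> x)) *\<^sub>R u k)"
        by (subst A)
          (simp add: matrix_vector_mult.sum_left matrix_vector_mult.scaleR_left outer_mult_vec)
      \<comment> \<open>The remainder of the expansion of \<open>x\<close> lies in the span and is orthogonal to it.\<close>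
      define z where "z = x - (\<Sum>k\<le>q. (w k \<bullet> x) *\<^sub>R w k)"
      have zw: "w l \<bullet> z = 0" if "l \<le> q" for l
      proof -
        have "w l \<bullet> (\<Sum>k\<le>q. (w k \<bullet> x) *\<^sub>R w k) = (\<Sum>k\<le>q. if k = l then w l \<bullet> x else 0)"
          unfolding inner_sum_right using that q w by (intro sum.cong) auto
        then show ?thesis using that by (simp add: z_def inner_diff_right)
      qed
      have "z \<in> span (w ` {..q})"
        unfolding z_def by (intro span_diff x span_sum span_scale span_base) auto
      moreover have "orthogonal z y" if "y \<in> span (w ` {..q})" for y
        using that by (rule orthogonal_to_span) (use zw in \<open>auto simp: orthogonal_def inner_commute\<close>)
      ultimately have "z = 0" by (metis orthogonal_self)
      then have x_eq: "x = (\<Sum>k\<le>q. (w k \<bullet> x) *\<^sub>R w k)" by (simp add: z_def)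
      have "(norm x)\<^sup>2 = (\<Sum>k\<le>q. (norm ((w k \<bullet> x) *\<^sub>R w k))\<^sup>2)"
        by (subst x_eq, rule norm_sum_Pythagorean)
          (use w q in \<open>auto simp: pairwise_def orthogonal_def\<close>)
      also have "\<dots> = (\<Sum>k\<le>q. (w k \<bullet> x)\<^sup>2)"
        using nu(2) q by (intro sum.cong) auto
      finally have nx: "(norm x)\<^sup>2 = (\<Sum>k\<le>q. (w k \<bullet> x)\<^sup>2)" .
      have "(norm (A *v x))\<^sup>2 = (\<Sum>k<m. (norm ((\<sigma> k * (w k \<bullet> x)) *\<^sub>R u k))\<^sup>2)"
        unfolding Ax by (rule norm_sum_Pythagorean)
          (use u in \<open>auto simp: pairwise_def orthogonal_def\<close>)
      also have "\<dots> = (\<Sum>k<m. (\<sigma> k)\<^sup>2 * (w k \<bullet> x)\<^sup>2)"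
        using nu(1) by (intro sum.cong) (auto simp: power_mult_distrib)
      finally have nAx: "(norm (A *v x))\<^sup>2 = (\<Sum>k<m. (\<sigma> k)\<^sup>2 * (w k \<bullet> x)\<^sup>2)" .
      have "(\<sigma> q * norm x)\<^sup>2 = (\<Sum>k\<le>q. (\<sigma> q)\<^sup>2 * (w k \<bullet> x)\<^sup>2)"
        by (simp add: power_mult_distrib nx sum_distrib_left)
      also have "\<dots> \<le> (\<Sum>k\<le>q. (\<sigma> k)\<^sup>2 * (w k \<bullet> x)\<^sup>2)"
        using decr q pos by (intro sum_mono mult_right_mono power_mono) auto
      also have "\<dots> \<le> (norm (A *v x))\<^sup>2"
        unfolding nAx using q by (intro sum_mono2) auto
      finally have "\<sigma> q * norm x \<le> norm (A *v x)"
        by (rule power2_le_imp_le) simp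
      also have "A *v x = (A - H) *v x"
        by (simp add: x matrix_vector_mult_diff_rdistrib)
      also have "norm \<dots> \<le> norm (A - H) * norm x"
        by (rule norm_matrix_vector_mult_le)
      finally have "\<sigma> q \<le> norm (A - H)" using x by simp
      moreover have "\<sigma> k \<le> \<sigma> q" using decr False k by simp
      moreover have "outer_product (P *v u k) (w k) = 0"
        using Pu[OF k] False by (simp add: outer_product_def vec_eq_iff)
      ultimately show ?thesis
        using pos[OF k] nu[OF k] by (simp add: norm_outer)
    qed
  qed
  also have "\<dots> = real m * norm (A - H)" by simp
  also have "\<dots> \<le> real CARD('m) * norm (A - H)"
    using m_le by (intro mult_right_mono) auto
  finally show ?thesis .
qed

section \<open>Matricizations and mode-wise products\<close>

lemma linear_matricization: "linear (matricization N \<alpha>)"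
  by (rule linearI) (simp_all add: matricization_def vec_eq_iff)

lemma linear_tensor_of_matrix: "linear (tensor_of_matrix N \<alpha>)"
  by (rule linearI) (simp_all add: tensor_of_matrix_def vec_eq_iff)

lemma bilinear_mode_apply: "bilinear (mode_apply N \<alpha>)"
  unfolding bilinear_def mode_apply_def
  by (auto intro!: linearI simp: linear_add[OF linear_matricization] linear_scale[OF linear_matricization]
      linear_add[OF linear_tensor_of_matrix] linear_scale[OF linear_tensor_of_matrix]
      matrix_mult.add_left matrix_mult.add_right matrix_mult.scaleR_left matrix_mult.scaleR_right)

lemma tensor_of_matrix_in_tensors: "tensor_of_matrix N \<alpha> X \<in> tensors N"
  by (simp add: tensor_of_matrix_def tensors_def)

lemma mode_apply_in_tensors: "mode_apply N \<alpha> A f \<in> tensors N"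
  by (simp add: mode_apply_def tensor_of_matrix_in_tensors)

lemma subspace_tensors: "subspace (tensors N)"
  by (auto simp: subspace_def tensors_def)

definition merge_index :: "'d set \<Rightarrow> ('d \<Rightarrow> 'n) \<Rightarrow> ('d \<Rightarrow> 'n) \<Rightarrow> 'd \<Rightarrow> 'n" where
  "merge_index \<alpha> i j = (\<lambda>\<mu>. if \<mu> \<in> \<alpha> then i \<mu> else j \<mu>)"

lemma matricization_nth:
  assumes "i \<in> Pi\<^sub>E \<alpha> N" "j \<in> Pi\<^sub>E (- \<alpha>) N"
  shows "matricization N \<alpha> f $ i $ j = f $ merge_index \<alpha> i j"
  using assms by (simp add: matricization_def merge_index_def)

lemma matricization_outside:
  assumes "\<not> (i \<in> Pi\<^sub>E \<alpha> N \<and> j \<in> Pi\<^sub>E (- \<alpha>) N)"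
  shows "matricization N \<alpha> f $ i $ j = 0"
  using assms unfolding matricization_def vec_lambda_beta by (rule if_not_P)

lemma norm_matricization_le: "norm (matricization N \<alpha> f) \<le> norm f"
proof -
  let ?I = "Pi\<^sub>E \<alpha> N \<times> Pi\<^sub>E (- \<alpha>) N"
  let ?h = "\<lambda>(i, j). merge_index \<alpha> i j"
  have inj: "inj_on ?h ?I"
  proof (rule inj_onI, clarify)
    fix i j i' j' assume *: "i \<in> Pi\<^sub>E \<alpha> N" "j \<in> Pi\<^sub>E (- \<alpha>) N" "i' \<in> Pi\<^sub>E \<alpha> N" "j' \<in> Pi\<^sub>E (- \<alpha>) N"
      and eq: "merge_index \<alpha> i j = merge_index \<alpha> i' j'"
    have "i \<mu> = i' \<mu>" if "\<mu> \<in> \<alpha>" for \<mu>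
      using fun_cong[OF eq, of \<mu>] that by (simp add: merge_index_def)
    moreover have "j \<mu> = j' \<mu>" if "\<mu> \<in> - \<alpha>" for \<mu>
      using fun_cong[OF eq, of \<mu>] that by (simp add: merge_index_def)
    ultimately show "i = i' \<and> j = j'" using * by (auto intro: PiE_ext)
  qed
  have "(norm (matricization N \<alpha> f))\<^sup>2 = (\<Sum>p\<in>UNIV. (matricization N \<alpha> f $ fst p $ snd p)\<^sup>2)"
    unfolding power2_norm_eq_inner inner_vec_def
    by (simp add: power2_eq_square sum.cartesian_product split_def flip: UNIV_Times_UNIV)
  also have "\<dots> = (\<Sum>p\<in>?I. (f $ ?h p)\<^sup>2)"
  proof (rule sum.mono_neutral_cong_right)
    show "\<forall>p\<in>UNIV - ?I. (matricization N \<alpha> f $ fst p $ snd p)\<^sup>2 = 0"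
      by (simp add: matricization_outside mem_Times_iff)
  qed (simp_all add: matricization_nth mem_Times_iff split_beta)
  also have "\<dots> = (\<Sum>i\<in>?h ` ?I. (f $ i)\<^sup>2)"
    by (subst sum.reindex[OF inj]) (simp add: o_def)
  also have "\<dots> \<le> (\<Sum>i\<in>UNIV. (f $ i)\<^sup>2)"
    by (rule sum_mono2) auto
  also have "\<dots> = (norm f)\<^sup>2"
    unfolding power2_norm_eq_inner inner_vec_def by (simp add: power2_eq_square)
  finally show ?thesis by (rule power2_le_imp_le) simp
qed

lemma norm_tensor_of_matrix_le: "norm (tensor_of_matrix N \<alpha> X) \<le> norm X"
proof -
  let ?h = "\<lambda>i. (restrict i \<alpha>, restrict i (- \<alpha>))"
  have inj: "inj_on ?h (Pi\<^sub>E UNIV N)"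
  proof (rule inj_onI, rule ext)
    fix i i' \<mu> assume eq: "?h i = ?h i'"
    have "restrict i \<alpha> \<mu> = restrict i' \<alpha> \<mu>" "restrict i (- \<alpha>) \<mu> = restrict i' (- \<alpha>) \<mu>"
      using eq by simp_all
    then show "i \<mu> = i' \<mu>"
      by (cases "\<mu> \<in> \<alpha>") auto
  qed
  have "(norm (tensor_of_matrix N \<alpha> X))\<^sup>2 = (\<Sum>i\<in>UNIV. (tensor_of_matrix N \<alpha> X $ i)\<^sup>2)"
    unfolding power2_norm_eq_inner inner_vec_def by (simp add: power2_eq_square)
  also have "\<dots> = (\<Sum>i\<in>Pi\<^sub>E UNIV N. (X $ fst (?h i) $ snd (?h i))\<^sup>2)"
    by (rule sum.mono_neutral_cong_right) (auto simp: tensor_of_matrix_def)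
  also have "\<dots> = (\<Sum>p\<in>?h ` Pi\<^sub>E UNIV N. (X $ fst p $ snd p)\<^sup>2)"
    by (subst sum.reindex[OF inj]) (simp add: o_def)
  also have "\<dots> \<le> (\<Sum>p\<in>UNIV. (X $ fst p $ snd p)\<^sup>2)"
    by (rule sum_mono2) auto
  also have "\<dots> = (norm X)\<^sup>2"
    unfolding power2_norm_eq_inner inner_vec_def
    by (simp add: power2_eq_square sum.cartesian_product split_def flip: UNIV_Times_UNIV)
  finally show ?thesis by (rule power2_le_imp_le) simp
qed

text \<open>
  Folding a matrix into a tensor and unfolding it again only zeroes the entries outside the index
  range; this matters because \<open>A ** matricization N \<alpha> f\<close> may have nonzero rows there.
\<close>

lemma matricization_of_tensor_of_matrix:
  "matricization N \<alpha> (tensor_of_matrix N \<alpha> X) $ i $ j =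
    (if i \<in> Pi\<^sub>E \<alpha> N \<and> j \<in> Pi\<^sub>E (- \<alpha>) N then X $ i $ j else 0)"
proof (cases "i \<in> Pi\<^sub>E \<alpha> N \<and> j \<in> Pi\<^sub>E (- \<alpha>) N")
  case True
  then have "merge_index \<alpha> i j \<in> Pi\<^sub>E UNIV N"
    "restrict (merge_index \<alpha> i j) \<alpha> = i" "restrict (merge_index \<alpha> i j) (- \<alpha>) = j"
    by (auto simp: merge_index_def PiE_def Pi_def restrict_def extensional_def fun_eq_iff)
  then show ?thesis
    using True by (simp add: matricization_nth tensor_of_matrix_def)
qed (auto simp: matricization_def)

lemma rank_matricization_mode_apply_same:
  "rank (matricization N \<alpha> (mode_apply N \<alpha> A f)) \<le> rank A"
proof -
  define D :: "real^('a \<Rightarrow> 'b)^('a \<Rightarrow> 'b)"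
    where "D = (\<chi> i j. if i = j \<and> i \<in> Pi\<^sub>E \<alpha> N then 1 else 0)"
  have D: "(D ** X) $ i $ j = (if i \<in> Pi\<^sub>E \<alpha> N then X $ i $ j else 0)" for X :: "real^('a \<Rightarrow> 'b)^('a \<Rightarrow> 'b)" and i j
  proof -
    have "(D ** X) $ i $ j = (\<Sum>k\<in>UNIV. if k = i then (if i \<in> Pi\<^sub>E \<alpha> N then X $ i $ j else 0) else 0)"
      unfolding matrix_matrix_mult_def D_def vec_lambda_beta by (rule sum.cong) auto
    then show ?thesis by simp
  qed
  have "matricization N \<alpha> (mode_apply N \<alpha> A f) = D ** (A ** matricization N \<alpha> f)"
    unfolding mode_apply_def vec_eq_iff matricization_of_tensor_of_matrix D
    by (auto simp: matrix_matrix_mult_def matricization_def intro!: sum.neutral)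
  also have "rank \<dots> \<le> rank A"
    using rank_mul_le_right rank_mul_le_left order_trans by blast
  finally show ?thesis .
qed

lemma matricization_Compl: "matricization N (- \<alpha>) f = transpose (matricization N \<alpha> f)"
  by (auto simp: matricization_def transpose_def vec_eq_iff intro!: arg_cong[of _ _ "($) f"])

lemma mode_apply_nth:
  assumes "i \<in> Pi\<^sub>E UNIV N"
  shows "mode_apply N \<beta> A f $ i =
    (\<Sum>k\<in>Pi\<^sub>E \<beta> N. A $ restrict i \<beta> $ k * f $ merge_index \<beta> k i)"
proof -
  have "mode_apply N \<beta> A f $ i =
      (\<Sum>k\<in>UNIV. A $ restrict i \<beta> $ k * matricization N \<beta> f $ k $ restrict i (- \<beta>))"
    using assms by (simp add: mode_apply_def tensor_of_matrix_def matrix_matrix_mult_def)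
  also have "\<dots> = (\<Sum>k\<in>Pi\<^sub>E \<beta> N. A $ restrict i \<beta> $ k * f $ merge_index \<beta> k i)"
  proof (rule sum.mono_neutral_cong_right)
    fix k assume k: "k \<in> Pi\<^sub>E \<beta> N"
    have "(\<lambda>\<mu>. if \<mu> \<in> \<beta> then k \<mu> else restrict i (- \<beta>) \<mu>) = merge_index \<beta> k i"
      by (auto simp: merge_index_def)
    moreover have "restrict i (- \<beta>) \<in> Pi\<^sub>E (- \<beta>) N" using assms by auto
    ultimately show "A $ restrict i \<beta> $ k * matricization N \<beta> f $ k $ restrict i (- \<beta>) =
        A $ restrict i \<beta> $ k * f $ merge_index \<beta> k i"
      using k by (simp add: matricization_def)
  qed (auto simp: matricization_def)
  finally show ?thesis .
qed

text \<open>
  A matrix acting on the modes \<open>\<beta>\<close> acts on the rows of every matricization with \<open>\<beta> \<subseteq> \<alpha>\<close>: its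
  Kronecker product with the identity on \<open>\<alpha> - \<beta>\<close> multiplies from the left.
\<close>

lemma matricization_mode_apply_subset:
  assumes "\<beta> \<subseteq> \<alpha>"
  obtains A' where "matricization N \<alpha> (mode_apply N \<beta> A f) = A' ** matricization N \<alpha> f"
proof -
  \<comment> \<open>The Kronecker product: row \<open>i\<close> is supported on the indices \<open>l\<close> that agree with \<open>i\<close>
    outside \<open>\<beta>\<close>.\<close>
  define A' :: "real^('a \<Rightarrow> 'b)^('a \<Rightarrow> 'b)" where
    "A' = (\<chi> i l. if i \<in> Pi\<^sub>E \<alpha> N \<and> l \<in> (\<lambda>k. merge_index \<beta> k i) ` Pi\<^sub>E \<beta> N
      then A $ restrict i \<beta> $ restrict l \<beta> else 0)"
  have "matricization N \<alpha> (mode_apply N \<beta> A f) $ i $ j = (A' ** matricization N \<alpha> f) $ i $ j" for i j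
  proof (cases "i \<in> Pi\<^sub>E \<alpha> N \<and> j \<in> Pi\<^sub>E (- \<alpha>) N")
    case True
    let ?m = "\<lambda>k. merge_index \<beta> k i"
    have inj: "inj_on ?m (Pi\<^sub>E \<beta> N)"
    proof (rule inj_onI)
      fix k k' assume "k \<in> Pi\<^sub>E \<beta> N" "k' \<in> Pi\<^sub>E \<beta> N" and eq: "?m k = ?m k'"
      moreover have "k \<mu> = k' \<mu>" if "\<mu> \<in> \<beta>" for \<mu>
        using fun_cong[OF eq, of \<mu>] that by (simp add: merge_index_def)
      ultimately show "k = k'" by (auto intro: PiE_ext)
    qed
    have ij: "merge_index \<alpha> i j \<in> Pi\<^sub>E UNIV N"
      using True by (auto simp: merge_index_def PiE_def Pi_def)
    have res: "restrict (merge_index \<alpha> i j) \<beta> = restrict i \<beta>"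
      using assms by (auto simp: merge_index_def fun_eq_iff)
    have "(A' ** matricization N \<alpha> f) $ i $ j = (\<Sum>l\<in>?m ` Pi\<^sub>E \<beta> N. A' $ i $ l * matricization N \<alpha> f $ l $ j)"
      unfolding matrix_matrix_mult_def vec_lambda_beta
      by (rule sum.mono_neutral_right) (auto simp: A'_def)
    also have "\<dots> = (\<Sum>k\<in>Pi\<^sub>E \<beta> N. A' $ i $ ?m k * matricization N \<alpha> f $ ?m k $ j)"
      by (subst sum.reindex[OF inj]) (simp add: o_def)
    also have "\<dots> = (\<Sum>k\<in>Pi\<^sub>E \<beta> N. A $ restrict i \<beta> $ k * f $ merge_index \<beta> k (merge_index \<alpha> i j))"
    proof (rule sum.cong)
      fix k assume k: "k \<in> Pi\<^sub>E \<beta> N"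
      have "restrict (?m k) \<beta> = k"
        using k by (auto simp: merge_index_def fun_eq_iff PiE_def extensional_def)
      then have 1: "A' $ i $ ?m k = A $ restrict i \<beta> $ k"
        using True k by (simp add: A'_def)
      have "?m k \<in> Pi\<^sub>E \<alpha> N"
        using True k assms by (auto simp: merge_index_def PiE_def Pi_def extensional_def)
      moreover have "merge_index \<alpha> (?m k) j = merge_index \<beta> k (merge_index \<alpha> i j)"
        using assms by (auto simp: merge_index_def fun_eq_iff)
      ultimately have 2: "matricization N \<alpha> f $ ?m k $ j = f $ merge_index \<beta> k (merge_index \<alpha> i j)"
        using True by (simp add: matricization_nth)
      show "A' $ i $ ?m k * matricization N \<alpha> f $ ?m k $ j =
          A $ restrict i \<beta> $ k * f $ merge_index \<beta> k (merge_index \<alpha> i j)"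
        by (simp add: 1 2)
    qed simp
    also have "\<dots> = mode_apply N \<beta> A f $ merge_index \<alpha> i j"
      by (simp add: mode_apply_nth[OF ij] res)
    also have "\<dots> = matricization N \<alpha> (mode_apply N \<beta> A f) $ i $ j"
      using True by (simp add: matricization_def merge_index_def)
    finally show ?thesis by simp
  next
    case False
    have "A' $ i $ l * matricization N \<alpha> f $ l $ j = 0" for l
    proof (cases "i \<in> Pi\<^sub>E \<alpha> N")
      case True
      then show ?thesis using False by (simp add: matricization_outside)
    qed (simp add: A'_def)
    then have "(A' ** matricization N \<alpha> f) $ i $ j = 0"
      by (simp only: matrix_matrix_mult_def vec_lambda_beta sum.neutral_const)
    then show ?thesis
      using matricization_outside[OF False] by simp
  qed
  then have "matricization N \<alpha> (mode_apply N \<beta> A f) = A' ** matricization N \<alpha> f"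
    by (simp add: vec_eq_iff)
  then show ?thesis by (rule that)
qed

text \<open>
  For \<open>\<beta>\<close> inside \<open>\<alpha>\<close> the product acts on rows; for \<open>\<beta>\<close> disjoint from \<open>\<alpha>\<close> it acts on columns, which
  is the first case for the complementary, transposed matricization.
\<close>

lemma rank_matricization_mode_apply_le:
  assumes "\<beta> \<subseteq> \<alpha> \<or> \<beta> \<inter> \<alpha> = {}"
  shows "rank (matricization N \<alpha> (mode_apply N \<beta> A f)) \<le> rank (matricization N \<alpha> f)"
  using assms
proof
  assume "\<beta> \<subseteq> \<alpha>"
  then show ?thesis
    by (metis matricization_mode_apply_subset rank_mul_le_right)
next
  assume "\<beta> \<inter> \<alpha> = {}"
  then have "\<beta> \<subseteq> - \<alpha>" by auto
  then have "rank (matricization N (- \<alpha>) (mode_apply N \<beta> A f)) \<le> rank (matricization N (- \<alpha>) f)"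
    by (metis matricization_mode_apply_subset rank_mul_le_right)
  then show ?thesis
    by (simp add: matricization_Compl rank_transpose)
qed

text \<open>
  The reason for processing a tree from the root downwards: once \<open>P \<alpha>\<close> has bounded the rank at \<open>\<alpha>\<close>,
  the remaining factors belong to subsets of \<open>\<alpha>\<close> or sets disjoint from it, and none of them raises
  that rank again. The argument concerns arbitrary matrices, so that it covers orthogonal projections as
  well as the affine families of low-rank matrices that produce curves on the manifold.
\<close>

lemma rank_fold_mode_apply_le:
  assumes "sorted_wrt (\<lambda>\<alpha> \<beta>. \<beta> \<subseteq> \<alpha> \<or> \<beta> \<inter> \<alpha> = {}) xs" "\<alpha> \<in> set xs"
  shows "rank (matricization N \<alpha> (fold (\<lambda>\<alpha>. mode_apply N \<alpha> (P \<alpha>)) xs f)) \<le> rank (P \<alpha>)"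
  using assms
proof (induction xs rule: rev_induct)
  case (snoc \<beta> xs)
  show ?case
  proof (cases "\<alpha> = \<beta>")
    case True
    then show ?thesis by (simp add: rank_matricization_mode_apply_same)
  next
    case False
    then have "\<alpha> \<in> set xs" "\<beta> \<subseteq> \<alpha> \<or> \<beta> \<inter> \<alpha> = {}"
      using snoc.prems by (auto simp: sorted_wrt_append)
    then show ?thesis
      using rank_matricization_mode_apply_le[of \<beta> \<alpha> N "P \<beta>" "fold (\<lambda>\<alpha>. mode_apply N \<alpha> (P \<alpha>)) xs f"]
        snoc by (fastforce simp: sorted_wrt_append)
  qed
qed simp

text \<open>
  With all modes in the rows there is one column index, the function that is undefined everywhere.
\<close>

lemma rank_matricization_UNIV_le: "rank (matricization N UNIV f) \<le> 1"
proof -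
  have "column j (matricization N UNIV f) \<in> {column (\<lambda>_. undefined) (matricization N UNIV f), 0}" for j
    by (auto simp: column_def matricization_def vec_eq_iff)
  then have "columns (matricization N UNIV f) \<subseteq> span {column (\<lambda>_. undefined) (matricization N UNIV f)}"
    unfolding columns_def by (force intro: span_base span_zero)
  then have "dim (columns (matricization N UNIV f)) \<le> card {column (\<lambda>_. undefined) (matricization N UNIV f)}"
    by (rule dim_le_card) simp
  then show ?thesis by (simp add: column_rank_def)
qed

section \<open>Layers of a dimension tree\<close>

lemma modes_nonempty: "modes t \<noteq> {}"
  by (induction t) auto

lemma finite_nodes: "finite (nodes t)"
  by (induction t) auto

lemma modes_in_nodes: "modes t \<in> nodes t"
  by (cases t) auto

lemma nodes_subset_modes: "\<alpha> \<in> nodes t \<Longrightarrow> \<alpha> \<subseteq> modes t"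
  by (induction t) auto

lemma layer_subset_nodes: "set (layer t k) \<subseteq> nodes t"
  by (induction t k rule: layer.induct) (auto simp: modes_in_nodes)

lemma layer_subset_modes: "\<alpha> \<in> set (layer t k) \<Longrightarrow> \<alpha> \<subseteq> modes t"
  using layer_subset_nodes nodes_subset_modes by blast

lemma node_in_layer: "\<alpha> \<in> nodes t \<Longrightarrow> \<exists>k\<le>depth t. \<alpha> \<in> set (layer t k)"
proof (induction t)
  case (Leaf \<mu>)
  then show ?case by (intro exI[of _ 0]) simp
next
  case (Node s t)
  consider "\<alpha> = modes s \<union> modes t" | "\<alpha> \<in> nodes s" | "\<alpha> \<in> nodes t"
    using Node.prems by auto
  then show ?case
  proof cases
    case 1
    then show ?thesis by (intro exI[of _ 0]) simp
  next
    case 2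
    then obtain k where "k \<le> depth s" "\<alpha> \<in> set (layer s k)" using Node.IH by blast
    then show ?thesis by (intro exI[of _ "Suc k"]) auto
  next
    case 3
    then obtain k where "k \<le> depth t" "\<alpha> \<in> set (layer t k)" using Node.IH by blast
    then show ?thesis by (intro exI[of _ "Suc k"]) auto
  qed
qed

lemma layer_disjoint:
  assumes "disjoint_children t"
  shows "sorted_wrt (\<lambda>\<alpha> \<beta>. \<beta> \<inter> \<alpha> = {}) (layer t k)"
  using assms
proof (induction t k rule: layer.induct)
  case (3 s t k)
  have "\<beta> \<inter> \<alpha> = {}" if "\<alpha> \<in> set (layer s k)" "\<beta> \<in> set (layer t k)" for \<alpha> \<beta>
    using layer_subset_modes[OF that(1)] layer_subset_modes[OF that(2)] "3.prems" by auto
  then show ?case using 3 by (simp add: sorted_wrt_append)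
qed auto

lemma deeper_layer_laminar:
  assumes "disjoint_children t" "k \<le> l" "\<alpha> \<in> set (layer t k)" "\<beta> \<in> set (layer t l)"
  shows "\<beta> \<subseteq> \<alpha> \<or> \<beta> \<inter> \<alpha> = {}"
  using assms
proof (induction t arbitrary: k l)
  case (Leaf \<mu>)
  then show ?case by (cases k; cases l) auto
next
  case (Node s t)
  show ?case
  proof (cases k)
    case 0
    then show ?thesis
      using Node.prems layer_subset_nodes[of "Node s t" l] nodes_subset_modes[of \<beta> "Node s t"] by auto
  next
    case (Suc k')
    then obtain l' where l: "l = Suc l'" "k' \<le> l'"
      using Node.prems by (cases l) auto
    have disj: "\<beta>' \<inter> \<alpha>' = {}"
      if "\<alpha>' \<in> set (layer s m)" "\<beta>' \<in> set (layer t n)" for \<alpha>' \<beta>' m n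
      using layer_subset_modes[OF that(1)] layer_subset_modes[OF that(2)] Node.prems(1) by auto
    have "\<alpha> \<in> set (layer s k') \<or> \<alpha> \<in> set (layer t k')" "\<beta> \<in> set (layer s l') \<or> \<beta> \<in> set (layer t l')"
      using Node.prems Suc l by auto
    then show ?thesis
      using Node.IH[of k' l'] l Node.prems(1) disj[of \<alpha> k' \<beta> l'] disj[of \<beta> l' \<alpha> k'] by auto
  qed
qed

text \<open>
  Listing layers by increasing depth yields the order required by \<open>rank_fold_mode_apply_le\<close>.
\<close>

lemma layers_top_down:
  assumes "disjoint_children t" "sorted ks" "distinct ks"
  shows "sorted_wrt (\<lambda>\<alpha> \<beta>. \<beta> \<subseteq> \<alpha> \<or> \<beta> \<inter> \<alpha> = {}) (concat (map (layer t) ks))"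
  using assms(2,3)
proof (induction ks)
  case (Cons k ks)
  have "sorted_wrt (\<lambda>\<alpha> \<beta>. \<beta> \<subseteq> \<alpha> \<or> \<beta> \<inter> \<alpha> = {}) (layer t k)"
    by (rule sorted_wrt_mono_rel[OF _ layer_disjoint[OF assms(1)]]) simp
  moreover have "\<beta> \<subseteq> \<alpha> \<or> \<beta> \<inter> \<alpha> = {}"
    if \<alpha>: "\<alpha> \<in> set (layer t k)" and \<beta>: "\<beta> \<in> set (concat (map (layer t) ks))" for \<alpha> \<beta>
  proof -
    obtain l where "l \<in> set ks" "\<beta> \<in> set (layer t l)" using \<beta> by auto
    then show ?thesis
      by (intro deeper_layer_laminar[OF assms(1) _ \<alpha>, of l]) (use Cons.prems in auto)
  qed
  ultimately show ?case
    using Cons.IH Cons.prems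
    unfolding list.map concat.simps sorted_wrt_append by simp
qed simp

lemma proper_layers:
  assumes "dimension_tree t"
  shows "set (concat (map (layer t) [1..<Suc (depth t)])) = nodes t - {UNIV}"
proof -
  have root: "UNIV \<notin> set (layer t (Suc k))" for k
  proof (cases t)
    case (Node a b)
    have "\<not> UNIV \<subseteq> modes a" "\<not> UNIV \<subseteq> modes b"
      using assms modes_nonempty[of a] modes_nonempty[of b] Node by (auto simp: dimension_tree_def)
    then show ?thesis
      using layer_subset_modes[of UNIV a k] layer_subset_modes[of UNIV b k] Node by auto
  qed auto
  have "\<alpha> \<in> nodes t - {UNIV} \<longleftrightarrow> (\<exists>k\<in>{1..<Suc (depth t)}. \<alpha> \<in> set (layer t k))" for \<alpha>
  proof
    assume \<alpha>: "\<alpha> \<in> nodes t - {UNIV}"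
    then obtain k where k: "k \<le> depth t" "\<alpha> \<in> set (layer t k)" using node_in_layer by blast
    have "k \<noteq> 0" using \<alpha> k assms by (auto simp: dimension_tree_def intro!: Nat.gr0I)
    then show "\<exists>k\<in>{1..<Suc (depth t)}. \<alpha> \<in> set (layer t k)" using k by auto
  next
    assume "\<exists>k\<in>{1..<Suc (depth t)}. \<alpha> \<in> set (layer t k)"
    then obtain k where "k \<in> {1..<Suc (depth t)}" "\<alpha> \<in> set (layer t k)" by blast
    then show "\<alpha> \<in> nodes t - {UNIV}"
      using root[of "k - 1"] layer_subset_nodes[of t k] by auto
  qed
  then show ?thesis
    unfolding set_concat set_map set_upt UN_simps by blast
qed

lemma all_layers:
  "set (concat (map (layer t) [0..<Suc (depth t)])) = nodes t"
proof
  show "set (concat (map (layer t) [0..<Suc (depth t)])) \<subseteq> nodes t"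
    using layer_subset_nodes[of t] by auto
  show "nodes t \<subseteq> set (concat (map (layer t) [0..<Suc (depth t)]))"
  proof
    fix \<alpha> assume "\<alpha> \<in> nodes t"
    then obtain k where "k < Suc (depth t)" "\<alpha> \<in> set (layer t k)"
      using node_in_layer less_Suc_eq_le by blast
    then show "\<alpha> \<in> set (concat (map (layer t) [0..<Suc (depth t)]))"
      unfolding set_concat set_map set_upt by force
  qed
qed

lemma fold_layers: "fold (\<lambda>k. fold F (layer t k)) ks = fold F (concat (map (layer t) ks))"
  by (induction ks) auto

section \<open>The tangent space of the hierarchical Tucker manifold\<close>

text \<open>
  The tensors whose matricization at every node is tangent to the matrices of the same rank as the
  matricization of \<open>g\<close>. The two-sided form \<open>B ** G + G ** C\<close> makes it evident that this is a subspace.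
\<close>

definition ht_linearized ::
  "('d::finite \<Rightarrow> 'n::finite set) \<Rightarrow> 'd dtree \<Rightarrow> real ^ ('d \<Rightarrow> 'n) \<Rightarrow> (real ^ ('d \<Rightarrow> 'n)) set" where
  "ht_linearized N t g = {v \<in> tensors N. \<forall>\<alpha>\<in>nodes t.
    \<exists>B C. matricization N \<alpha> v = B ** matricization N \<alpha> g + matricization N \<alpha> g ** C}"

lemmas bounded_linear_matricization = linear_matricization[THEN linear_conv_bounded_linear[THEN iffD1]]

lemma subspace_ht_linearized: "subspace (ht_linearized N t g)"
proof (rule subspaceI)
  show "0 \<in> ht_linearized N t g"
    by (auto simp: ht_linearized_def subspace_0[OF subspace_tensors] linear_0[OF linear_matricization]
        intro!: exI[of _ 0])
  fix x y assume x: "x \<in> ht_linearized N t g" and y: "y \<in> ht_linearized N t g"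
  have "\<exists>B C. matricization N \<alpha> (x + y) = B ** matricization N \<alpha> g + matricization N \<alpha> g ** C"
    if \<alpha>: "\<alpha> \<in> nodes t" for \<alpha>
  proof -
    obtain B C B' C' where "matricization N \<alpha> x = B ** matricization N \<alpha> g + matricization N \<alpha> g ** C"
      "matricization N \<alpha> y = B' ** matricization N \<alpha> g + matricization N \<alpha> g ** C'"
      using x y \<alpha> unfolding ht_linearized_def by blast
    then have "matricization N \<alpha> (x + y) =
        (B + B') ** matricization N \<alpha> g + matricization N \<alpha> g ** (C + C')"
      by (simp add: linear_add[OF linear_matricization] matrix_mult.add_left matrix_mult.add_right)
    then show ?thesis by blast
  qed
  then show "x + y \<in> ht_linearized N t g"
    using x y by (simp add: ht_linearized_def subspace_add[OF subspace_tensors])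
next
  fix c x assume x: "x \<in> ht_linearized N t g"
  have "\<exists>B C. matricization N \<alpha> (c *\<^sub>R x) = B ** matricization N \<alpha> g + matricization N \<alpha> g ** C"
    if \<alpha>: "\<alpha> \<in> nodes t" for \<alpha>
  proof -
    obtain B C where "matricization N \<alpha> x = B ** matricization N \<alpha> g + matricization N \<alpha> g ** C"
      using x \<alpha> unfolding ht_linearized_def by blast
    then have "matricization N \<alpha> (c *\<^sub>R x) =
        (c *\<^sub>R B) ** matricization N \<alpha> g + matricization N \<alpha> g ** (c *\<^sub>R C)"
      by (simp add: linear_scale[OF linear_matricization] matrix_mult.scaleR_left
          matrix_mult.scaleR_right scaleR_right_distrib)
    then show ?thesis by blast
  qed
  then show "c *\<^sub>R x \<in> ht_linearized N t g"
    using x by (simp add: ht_linearized_def subspace_scale[OF subspace_tensors])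
qed

text \<open>
  This is stated for right-sided velocities and the rank-bounded set, so that it applies both to
  smooth curves on the manifold and to the values of a truncation along a line.
\<close>

lemma velocity_in_ht_linearized:
  assumes g: "g \<in> ht_manifold N t r"
    and lim: "((\<lambda>s. (1 / s) *\<^sub>R (h s - g)) \<longlongrightarrow> w) (at_right 0)"
    and h: "\<forall>\<^sub>F s in at_right 0. h s \<in> ht_closure N t r"
  shows "w \<in> ht_linearized N t g"
proof -
  have gN: "g \<in> tensors N" using g by (simp add: ht_manifold_def)
  have "\<forall>\<^sub>F s in at_right 0. (1 / s) *\<^sub>R (h s - g) \<in> tensors N"
    using h by eventually_elim
      (auto simp: ht_closure_def gN intro!: subspace_scale[OF subspace_tensors] subspace_diff[OF subspace_tensors])
  then have "w \<in> tensors N"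
    by (rule Lim_in_closed_set[OF closed_subspace[OF subspace_tensors] _ _ lim]) simp
  moreover have "\<exists>B C. matricization N \<alpha> w = B ** matricization N \<alpha> g + matricization N \<alpha> g ** C"
    if \<alpha>: "\<alpha> \<in> nodes t" for \<alpha>
  proof (rule velocity_of_bounded_rank_curve)
    show "((\<lambda>s. (1 / s) *\<^sub>R (matricization N \<alpha> (h s) - matricization N \<alpha> g))
        \<longlongrightarrow> matricization N \<alpha> w) (at_right 0)"
      using bounded_linear.tendsto[OF bounded_linear_matricization lim, of N \<alpha>]
      by (simp add: linear_scale[OF linear_matricization] linear_diff[OF linear_matricization])
    show "\<forall>\<^sub>F s in at_right 0. rank (matricization N \<alpha> (h s)) \<le> rank (matricization N \<alpha> g)"
      using h by eventually_elim (use g \<alpha> in \<open>auto simp: ht_closure_def ht_manifold_def\<close>)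
  qed
  ultimately show ?thesis by (simp add: ht_linearized_def)
qed

lemma tangent_space_subset_ht_linearized:
  assumes "g \<in> ht_manifold N t r"
  shows "tangent_space (ht_manifold N t r) g \<subseteq> ht_linearized N t g"
proof
  fix w assume "w \<in> tangent_space (ht_manifold N t r) g"
  then obtain c \<epsilon> where \<epsilon>: "0 < \<epsilon>" and c: "c ` {-\<epsilon><..<\<epsilon>} \<subseteq> ht_manifold N t r" "c 0 = g"
    and der: "(c has_vector_derivative w) (at 0)"
    unfolding tangent_space_def by blast
  show "w \<in> ht_linearized N t g"
  proof (rule velocity_in_ht_linearized[OF assms])
    have "((\<lambda>h. norm (c h - g - h *\<^sub>R w) / norm h) \<longlongrightarrow> 0) (at 0)"
      using der by (simp add: has_vector_derivative_def has_derivative_at c)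
    moreover have "\<forall>\<^sub>F h in at 0. norm (c h - g - h *\<^sub>R w) / norm h = norm ((1 / h) *\<^sub>R (c h - g) - w)"
      unfolding eventually_at_filter
    proof (rule always_eventually, intro allI impI)
      fix h :: real assume "h \<noteq> 0"
      then have "(1 / h) *\<^sub>R (c h - g) - w = (1 / h) *\<^sub>R (c h - g - h *\<^sub>R w)"
        by (simp add: scaleR_diff_right)
      then show "norm (c h - g - h *\<^sub>R w) / norm h = norm ((1 / h) *\<^sub>R (c h - g) - w)"
        by simp
    qed
    ultimately have "((\<lambda>h. norm ((1 / h) *\<^sub>R (c h - g) - w)) \<longlongrightarrow> 0) (at 0)"
      by (rule Lim_transform_eventually)
    then have "((\<lambda>h. (1 / h) *\<^sub>R (c h - g)) \<longlongrightarrow> w) (at 0)"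
      by (simp only: tendsto_norm_zero_iff flip: Lim_null)
    then show "((\<lambda>h. (1 / h) *\<^sub>R (c h - g)) \<longlongrightarrow> w) (at_right 0)"
      by (rule tendsto_mono[rotated]) (simp add: at_le)
    have "\<forall>\<^sub>F s in at_right 0. s \<in> {0<..<\<epsilon>}"
      using \<epsilon> by (rule eventually_at_right_real)
    then show "\<forall>\<^sub>F s in at_right 0. c s \<in> ht_closure N t r"
    proof eventually_elim
      case (elim s)
      then have "c s \<in> ht_manifold N t r" using c by auto
      then show ?case by (simp add: ht_manifold_def ht_closure_def)
    qed
  qed
qed

text \<open>
  An affine family of matrices of rank at most \<open>rank G\<close> that fixes \<open>G + s *\<^sub>R V\<close> up to terms of second
  order: take the projection \<open>P = G ** Y\<close> onto the range of \<open>G\<close> and turn it by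
  \<open>mat 1 + s *\<^sub>R (B - P ** B)\<close>. Then \<open>P ** V + (B - P ** B) ** G = B ** G + G ** C\<close>. Being
  affine in \<open>s\<close>, unlike an orthogonal projection onto a moving subspace, the family yields polynomial
  and therefore smooth curves.
\<close>

lemma first_order_exact_factor:
  fixes G V :: "real^'n^'m"
  assumes "V = B ** G + G ** C"
  obtains P Q where "P ** G = G" "P ** V + Q ** G = V" "\<And>s. rank (P + s *\<^sub>R Q) \<le> rank G"
proof -
  obtain Y :: "real^'m^'n" where Y: "G ** Y ** G = G"
    by (rule generalized_inverse_exists)
  define P where "P = G ** Y"
  define Q where "Q = (B - P ** B) ** P"
  show ?thesis
  proof
    show PG: "P ** G = G" by (simp add: P_def Y)
    have "P ** V + Q ** G = P ** B ** G + P ** G ** C + (B - P ** B) ** (P ** G)"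
      by (simp add: assms Q_def matrix_mult.add_right matrix_mul_assoc)
    also have "\<dots> = V"
      by (simp add: PG matrix_mult.diff_left assms)
    finally show "P ** V + Q ** G = V" .
    fix s
    have "P + s *\<^sub>R Q = (mat 1 + s *\<^sub>R (B - P ** B)) ** P"
      by (simp add: Q_def matrix_mult.add_left matrix_mult.scaleR_left)
    also have "rank \<dots> \<le> rank P" by (rule rank_mul_le_right)
    also have "\<dots> \<le> rank G" unfolding P_def by (rule rank_mul_le_left)
    finally show "rank (P + s *\<^sub>R Q) \<le> rank G" .
  qed
qed

lemma bounded_linear_mode_apply: "bounded_linear (mode_apply N \<alpha> A)"
  using bilinear_mode_apply by (auto simp: bilinear_def linear_conv_bounded_linear)

lemma mode_apply_add_scaleR:
  "mode_apply N \<alpha> (P + s *\<^sub>R Q) f = mode_apply N \<alpha> P f + s *\<^sub>R mode_apply N \<alpha> Q f"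
  by (simp add: bilinear_ladd[OF bilinear_mode_apply] bilinear_lmul[OF bilinear_mode_apply])

text \<open>
  Each factor reproduces the line \<open>g + s *\<^sub>R v\<close> up to \<open>s\<^sup>2\<close>, and applying a further factor keeps the
  \<open>s\<^sup>2\<close>-term polynomial; so the whole product does the same, whatever the order of the nodes.
\<close>

lemma fold_mode_apply_second_order:
  assumes "\<And>\<alpha>. \<alpha> \<in> set xs \<Longrightarrow> mode_apply N \<alpha> (P \<alpha>) g = g"
    and "\<And>\<alpha>. \<alpha> \<in> set xs \<Longrightarrow> mode_apply N \<alpha> (P \<alpha>) v + mode_apply N \<alpha> (Q \<alpha>) g = v"
  obtains q where "polynomial_function q"
    "\<And>s. fold (\<lambda>\<alpha>. mode_apply N \<alpha> (P \<alpha> + s *\<^sub>R Q \<alpha>)) xs (g + s *\<^sub>R v) = g + s *\<^sub>R v + s\<^sup>2 *\<^sub>R q s"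
proof -
  have "\<exists>q. polynomial_function q \<and>
    (\<forall>s. fold (\<lambda>\<alpha>. mode_apply N \<alpha> (P \<alpha> + s *\<^sub>R Q \<alpha>)) xs (g + s *\<^sub>R v) = g + s *\<^sub>R v + s\<^sup>2 *\<^sub>R q s)"
    using assms
  proof (induction xs rule: rev_induct)
    case Nil
    then show ?case by (intro exI[of _ "\<lambda>_. 0"]) simp
  next
    case (snoc \<alpha> xs)
    then obtain q where q: "polynomial_function q"
      and fold: "\<And>s. fold (\<lambda>\<alpha>. mode_apply N \<alpha> (P \<alpha> + s *\<^sub>R Q \<alpha>)) xs (g + s *\<^sub>R v) = g + s *\<^sub>R v + s\<^sup>2 *\<^sub>R q s"
      by auto
    let ?P = "mode_apply N \<alpha> (P \<alpha>)" and ?Q = "mode_apply N \<alpha> (Q \<alpha>)"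
    define q' where "q' s = ?Q v + ?P (q s) + s *\<^sub>R ?Q (q s)" for s
    have comp: "polynomial_function (\<lambda>s. mode_apply N \<alpha> A (q s))" for A
      using polynomial_function_compose[OF q polynomial_function_bounded_linear[OF bounded_linear_mode_apply]]
      by (simp add: o_def)
    have "polynomial_function q'"
      unfolding q'_def by (intro polynomial_function_add polynomial_function_mult comp) auto
    moreover have "mode_apply N \<alpha> (P \<alpha> + s *\<^sub>R Q \<alpha>) (g + s *\<^sub>R v + s\<^sup>2 *\<^sub>R q s) = g + s *\<^sub>R v + s\<^sup>2 *\<^sub>R q' s" for s
    proof -
      have Pg: "?P g = g" and Qg: "?Q g = v - ?P v"
        using snoc.prems(1)[of \<alpha>] snoc.prems(2)[of \<alpha>] by (simp_all add: algebra_simps)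
      have "mode_apply N \<alpha> (P \<alpha> + s *\<^sub>R Q \<alpha>) (g + s *\<^sub>R v + s\<^sup>2 *\<^sub>R q s) =
        ?P g + s *\<^sub>R ?P v + s\<^sup>2 *\<^sub>R ?P (q s) + s *\<^sub>R (?Q g + s *\<^sub>R ?Q v + s\<^sup>2 *\<^sub>R ?Q (q s))"
        by (simp add: mode_apply_add_scaleR bilinear_radd[OF bilinear_mode_apply]
            bilinear_rmul[OF bilinear_mode_apply] scaleR_right_distrib scaleR_left_commute add_ac)
      then show ?thesis
        unfolding Pg Qg q'_def by (simp add: algebra_simps power2_eq_square)
    qed
    ultimately show ?case
      by (intro exI[of _ q']) (simp add: fold)
  qed
  then show ?thesis using that by blast
qed

lemma fold_mode_apply_in_tensors:
  "f \<in> tensors N \<Longrightarrow> fold (\<lambda>\<alpha>. mode_apply N \<alpha> (P \<alpha>)) xs f \<in> tensors N"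
  by (induction xs rule: rev_induct) (auto simp: mode_apply_in_tensors)

lemma polynomial_function_second_order:
  assumes "polynomial_function q"
  shows "polynomial_function (\<lambda>s::real. a + s *\<^sub>R b + s\<^sup>2 *\<^sub>R q s)"
proof -
  have "polynomial_function (\<lambda>s. s\<^sup>2 :: real)"
    unfolding real_polynomial_function_eq[symmetric]
    by (intro real_polynomial_function_power) (simp add: real_polynomial_function_eq)
  then show ?thesis
    by (intro polynomial_function_add polynomial_function_mult assms) auto
qed

text \<open>
  This is where the tree is used: the conditions at the individual nodes can be met simultaneously.
  A low-rank factor is applied at every node from the root downwards. The top-down order bounds
  all ranks by \<open>r\<close>, and near \<open>s = 0\<close> semicontinuity makes the bounds equalities.
\<close>

lemma ht_linearized_second_order_curve:
  assumes g: "g \<in> ht_manifold N t r" and v: "v \<in> ht_linearized N t g" and t: "dimension_tree t"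
  obtains q \<epsilon> where "polynomial_function q" "0 < \<epsilon>"
    "\<And>s. \<bar>s\<bar> < \<epsilon> \<Longrightarrow> g + s *\<^sub>R v + s\<^sup>2 *\<^sub>R q s \<in> ht_manifold N t r"
proof -
  have gN: "g \<in> tensors N" and vN: "v \<in> tensors N"
    using g v by (simp_all add: ht_manifold_def ht_linearized_def)
  have "\<exists>P Q. P ** matricization N \<alpha> g = matricization N \<alpha> g \<and>
      P ** matricization N \<alpha> v + Q ** matricization N \<alpha> g = matricization N \<alpha> v \<and>
      (\<forall>s. rank (P + s *\<^sub>R Q) \<le> rank (matricization N \<alpha> g))" if \<alpha>: "\<alpha> \<in> nodes t" for \<alpha>
  proof -
    obtain B C where "matricization N \<alpha> v = B ** matricization N \<alpha> g + matricization N \<alpha> g ** C"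
      using v \<alpha> unfolding ht_linearized_def by blast
    from first_order_exact_factor[OF this] show ?thesis by metis
  qed
  then obtain P Q where PQ:
    "\<And>\<alpha>. \<alpha> \<in> nodes t \<Longrightarrow> P \<alpha> ** matricization N \<alpha> g = matricization N \<alpha> g"
    "\<And>\<alpha>. \<alpha> \<in> nodes t \<Longrightarrow>
      P \<alpha> ** matricization N \<alpha> v + Q \<alpha> ** matricization N \<alpha> g = matricization N \<alpha> v"
    "\<And>\<alpha> s. \<alpha> \<in> nodes t \<Longrightarrow> rank (P \<alpha> + s *\<^sub>R Q \<alpha>) \<le> rank (matricization N \<alpha> g)"
    by metis
  define xs where "xs = concat (map (layer t) [0..<Suc (depth t)])"
  have xs: "set xs = nodes t" unfolding xs_def by (rule all_layers)
  have sorted: "sorted_wrt (\<lambda>\<alpha> \<beta>. \<beta> \<subseteq> \<alpha> \<or> \<beta> \<inter> \<alpha> = {}) xs"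
    unfolding xs_def using t by (intro layers_top_down) (simp_all add: dimension_tree_def del: upt_Suc)
  define c where "c s = fold (\<lambda>\<alpha>. mode_apply N \<alpha> (P \<alpha> + s *\<^sub>R Q \<alpha>)) xs (g + s *\<^sub>R v)" for s
  obtain q where q: "polynomial_function q" and c: "\<And>s. c s = g + s *\<^sub>R v + s\<^sup>2 *\<^sub>R q s"
  proof (rule fold_mode_apply_second_order[of xs N P g v Q])
    fix \<alpha> assume "\<alpha> \<in> set xs"
    then have \<alpha>: "\<alpha> \<in> nodes t" by (simp add: xs)
    show "mode_apply N \<alpha> (P \<alpha>) g = g"
      by (simp add: mode_apply_def PQ(1)[OF \<alpha>] tensor_of_matricization gN)
    have "mode_apply N \<alpha> (P \<alpha>) v + mode_apply N \<alpha> (Q \<alpha>) g = tensor_of_matrix N \<alpha> (matricization N \<alpha> v)"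
      by (simp add: mode_apply_def PQ(2)[OF \<alpha>] flip: linear_add[OF linear_tensor_of_matrix])
    then show "mode_apply N \<alpha> (P \<alpha>) v + mode_apply N \<alpha> (Q \<alpha>) g = v"
      by (simp add: tensor_of_matricization vN)
  qed (use that in \<open>auto simp: c_def\<close>)
  have cN: "c s \<in> tensors N" for s
    unfolding c_def using gN vN
    by (intro fold_mode_apply_in_tensors subspace_add[OF subspace_tensors] subspace_scale[OF subspace_tensors])
  have upper: "rank (matricization N \<alpha> (c s)) \<le> r \<alpha>" if "\<alpha> \<in> nodes t" for \<alpha> s
  proof -
    have "rank (matricization N \<alpha> (c s)) \<le> rank (P \<alpha> + s *\<^sub>R Q \<alpha>)"
      unfolding c_def using that xs by (intro rank_fold_mode_apply_le[OF sorted]) simp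
    also have "\<dots> \<le> rank (matricization N \<alpha> g)" using PQ(3)[OF that] .
    finally show ?thesis using g that by (simp add: ht_manifold_def)
  qed
  have "isCont c 0"
    unfolding c[abs_def]
    by (rule continuous_polymonial_function[OF polynomial_function_second_order[OF q]])
  then have "(c \<longlongrightarrow> g) (at 0)" by (simp add: isCont_def c)
  then have "\<forall>\<^sub>F s in at 0. r \<alpha> \<le> rank (matricization N \<alpha> (c s))" if "\<alpha> \<in> nodes t" for \<alpha>
    using rank_lower_semicontinuous[OF bounded_linear.tendsto[OF bounded_linear_matricization], of c g "at 0" N \<alpha>]
      g that by (simp add: ht_manifold_def)
  then have "\<forall>\<^sub>F s in at 0. \<forall>\<alpha>\<in>nodes t. r \<alpha> \<le> rank (matricization N \<alpha> (c s))"
    by (simp add: eventually_ball_finite finite_nodes)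
  then obtain \<epsilon> where \<epsilon>: "0 < \<epsilon>"
    "\<And>s. s \<noteq> 0 \<Longrightarrow> \<bar>s\<bar> < \<epsilon> \<Longrightarrow> \<forall>\<alpha>\<in>nodes t. r \<alpha> \<le> rank (matricization N \<alpha> (c s))"
    unfolding eventually_at by auto
  have "c s \<in> ht_manifold N t r" if "\<bar>s\<bar> < \<epsilon>" for s
  proof (cases "s = 0")
    case True
    then show ?thesis using g by (simp add: c)
  next
    case False
    then show ?thesis
      using \<epsilon>(2)[of s] upper[of _ s] that cN by (auto simp: ht_manifold_def intro!: antisym)
  qed
  then show ?thesis using that[OF q \<epsilon>(1)] c by simp
qed

lemma smooth_curve_on_polynomial_function:
  fixes p :: "real \<Rightarrow> 'a::euclidean_space"
  assumes "polynomial_function p"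
  shows "smooth_curve_on S p"
proof -
  have "\<exists>p'. polynomial_function p' \<and> (\<forall>x. (p has_vector_derivative p' x) (at x))"
    if "polynomial_function p" for p :: "real \<Rightarrow> 'a"
    using has_vector_derivative_polynomial_function[OF that] by metis
  then obtain d where d: "\<And>p :: real \<Rightarrow> 'a. polynomial_function p \<Longrightarrow>
      polynomial_function (d p) \<and> (\<forall>x. (p has_vector_derivative d p x) (at x))"
    by metis
  have "polynomial_function ((d ^^ k) p)" for k
    by (induction k) (use d assms in auto)
  then show ?thesis
    unfolding smooth_curve_on_def using d by (intro exI[of _ "\<lambda>k. (d ^^ k) p"]) simp
qed

text \<open>
  In particular the velocities of smooth curves form a subspace, so the orthogonal projection onto
  them is meaningful.
\<close>

lemma tangent_space_ht_manifold:
  assumes g: "g \<in> ht_manifold N t r" and t: "dimension_tree t"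
  shows "tangent_space (ht_manifold N t r) g = ht_linearized N t g"
proof
  show "tangent_space (ht_manifold N t r) g \<subseteq> ht_linearized N t g"
    by (rule tangent_space_subset_ht_linearized[OF g])
  show "ht_linearized N t g \<subseteq> tangent_space (ht_manifold N t r) g"
  proof
    fix v assume "v \<in> ht_linearized N t g"
    then obtain q \<epsilon> where q: "polynomial_function q" and \<epsilon>: "0 < \<epsilon>"
      and c: "\<And>s. \<bar>s\<bar> < \<epsilon> \<Longrightarrow> g + s *\<^sub>R v + s\<^sup>2 *\<^sub>R q s \<in> ht_manifold N t r"
      using ht_linearized_second_order_curve[OF g _ t] by blast
    let ?c = "\<lambda>s. g + s *\<^sub>R v + s\<^sup>2 *\<^sub>R q s"
    have "smooth_curve_on {-\<epsilon><..<\<epsilon>} ?c"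
      by (rule smooth_curve_on_polynomial_function[OF polynomial_function_second_order[OF q]])
    moreover obtain q' where "\<And>x. (q has_vector_derivative q' x) (at x)"
      using has_vector_derivative_polynomial_function[OF q] by blast
    then have "(?c has_vector_derivative v) (at 0)"
      by (auto intro!: derivative_eq_intros simp: power2_eq_square)
    moreover have "?c ` {-\<epsilon><..<\<epsilon>} \<subseteq> ht_manifold N t r" using c by auto
    ultimately show "v \<in> tangent_space (ht_manifold N t r) g"
      unfolding tangent_space_def using \<epsilon> by (intro CollectI exI[of _ ?c] exI[of _ \<epsilon>]) simp
  qed
qed

section \<open>Quasi-optimal truncations\<close>

text \<open>
  The truncation applies no projection at the root. There the rank is at most \<open>1\<close> anyway, so only
  \<open>r UNIV = 0\<close> needs care: then the manifold is \<open>{0}\<close>, all ranks vanish, and the projection at a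
  child of the root is zero. The child exists because there are at least two modes.
\<close>

lemma svd_truncation_in_closure:
  assumes card: "CARD('d) \<ge> 2" and t: "dimension_tree t"
    and r: "ht_manifold N t r \<noteq> {}" and f: "f \<in> tensors N"
    and h: "is_svd_truncation N t r f h"
  shows "h \<in> ht_closure N (t :: 'd::finite dtree) r"
proof -
  obtain P where P: "\<And>\<alpha>. \<alpha> \<in> nodes t - {UNIV} \<Longrightarrow>
      is_leading_projection (Pi\<^sub>E \<alpha> N) (Pi\<^sub>E (- \<alpha>) N) (matricization N \<alpha> f) (r \<alpha>) (P \<alpha>)"
    and h: "h = fold (\<lambda>\<alpha>. mode_apply N \<alpha> (P \<alpha>)) (concat (map (layer t) [1..<Suc (depth t)])) f"
    using h by (auto simp: is_svd_truncation_def fold_layers simp del: upt_Suc)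
  have hN: "h \<in> tensors N"
    unfolding h by (rule fold_mode_apply_in_tensors[OF f])
  have sorted: "sorted_wrt (\<lambda>\<alpha> \<beta>. \<beta> \<subseteq> \<alpha> \<or> \<beta> \<inter> \<alpha> = {}) (concat (map (layer t) [1..<Suc (depth t)]))"
    using t by (intro layers_top_down) (simp_all add: dimension_tree_def del: upt_Suc)
  have proper: "rank (matricization N \<alpha> h) \<le> r \<alpha>" if \<alpha>: "\<alpha> \<in> nodes t - {UNIV}" for \<alpha>
  proof -
    have "rank (matricization N \<alpha> h) \<le> rank (P \<alpha>)"
      unfolding h using \<alpha> by (intro rank_fold_mode_apply_le[OF sorted]) (simp only: proper_layers[OF t])
    also have "\<dots> \<le> r \<alpha>" by (rule rank_leading_projection_le[OF P[OF \<alpha>]])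
    finally show ?thesis .
  qed
  have root: "rank (matricization N UNIV h) \<le> r UNIV"
  proof (cases "r UNIV = 0")
    case True
    obtain g where g: "g \<in> tensors N" "\<And>\<alpha>. \<alpha> \<in> nodes t \<Longrightarrow> rank (matricization N \<alpha> g) = r \<alpha>"
      using r by (auto simp: ht_manifold_def)
    have "UNIV \<in> nodes t" using modes_in_nodes[of t] t by (simp add: dimension_tree_def)
    then have "matricization N UNIV g = 0" using g(2) True by (simp flip: rank_eq_0)
    then have "g = 0"
      using tensor_of_matricization[OF g(1), of UNIV] by (simp add: linear_0[OF linear_tensor_of_matrix])
    obtain a b where ab: "t = Node a b"
      using card t by (cases t) (auto simp: dimension_tree_def dest!: arg_cong[of _ _ card])
    have "modes a \<noteq> UNIV"
      using t ab modes_nonempty[of b] by (auto simp: dimension_tree_def)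
    then have a: "modes a \<in> nodes t - {UNIV}" using ab modes_in_nodes[of a] by simp
    then have "r (modes a) = 0"
      using g(2)[of "modes a"] \<open>g = 0\<close> by (simp add: linear_0[OF linear_matricization])
    then have "matricization N (modes a) h = 0"
      using proper[OF a] by (simp flip: rank_eq_0)
    then have "h = 0"
      using tensor_of_matricization[OF hN, of "modes a"] by (simp add: linear_0[OF linear_tensor_of_matrix])
    then show ?thesis by (simp add: linear_0[OF linear_matricization])
  next
    case False
    then show ?thesis using rank_matricization_UNIV_le[of N h] by linarith
  qed
  show ?thesis
    using hN proper root by (auto simp: ht_closure_def)
qed

text \<open>
  Telescoping \<open>f - F x y = (f - F x f) + F x (f - y)\<close>.
\<close>

lemma norm_diff_fold_contractions_le:
  fixes F :: "'a \<Rightarrow> 'b::real_normed_vector \<Rightarrow> 'b"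
  assumes "\<And>x. x \<in> set xs \<Longrightarrow> linear (F x)"
    and "\<And>x y. x \<in> set xs \<Longrightarrow> norm (F x y) \<le> norm y"
    and "\<And>x. x \<in> set xs \<Longrightarrow> norm (f - F x f) \<le> e"
  shows "norm (f - fold F xs f) \<le> real (length xs) * e"
  using assms
proof (induction xs rule: rev_induct)
  case (snoc x xs)
  let ?y = "fold F xs f"
  have "f - F x ?y = (f - F x f) + F x (f - ?y)"
    using linear_diff[OF snoc.prems(1)[of x]] by simp
  also have "norm \<dots> \<le> norm (f - F x f) + norm (F x (f - ?y))" by (rule norm_triangle_ineq)
  also have "\<dots> \<le> e + norm (f - ?y)" by (intro add_mono snoc.prems) simp_all
  also have "norm (f - ?y) \<le> real (length xs) * e" using snoc by simp
  finally show ?case by (simp add: algebra_simps)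
qed simp

text \<open>
  All projections are computed from \<open>f\<close> itself, so every factor alone has an error comparable to that
  of the best approximation of the matricization, and these errors add up. Any constant that does
  not depend on \<open>f\<close> serves the purpose.
\<close>

lemma svd_truncation_quasi_optimal:
  assumes t: "dimension_tree t"
  obtains c where "0 \<le> c" "\<And>f h y. f \<in> tensors N \<Longrightarrow> is_svd_truncation N t r f h \<Longrightarrow>
    y \<in> ht_closure N t r \<Longrightarrow> norm (f - h) \<le> c * norm (f - y)"
proof
  let ?xs = "concat (map (layer t) [1..<Suc (depth t)])"
  let ?m = "real CARD('a \<Rightarrow> 'b)"
  show "0 \<le> real (length ?xs) * ?m" by simp
  fix f h y assume f: "f \<in> tensors N" and h: "is_svd_truncation N t r f h" and y: "y \<in> ht_closure N t r"
  obtain P where P: "\<And>\<alpha>. \<alpha> \<in> nodes t - {UNIV} \<Longrightarrow>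
      is_leading_projection (Pi\<^sub>E \<alpha> N) (Pi\<^sub>E (- \<alpha>) N) (matricization N \<alpha> f) (r \<alpha>) (P \<alpha>)"
    and h: "h = fold (\<lambda>\<alpha>. mode_apply N \<alpha> (P \<alpha>)) ?xs f"
    using h by (auto simp: is_svd_truncation_def fold_layers simp del: upt_Suc)
  have "norm (f - h) \<le> real (length ?xs) * (?m * norm (f - y))"
    unfolding h
  proof (rule norm_diff_fold_contractions_le)
    fix \<alpha> assume "\<alpha> \<in> set ?xs"
    then have \<alpha>: "\<alpha> \<in> nodes t - {UNIV}" by (simp only: proper_layers[OF t])
    note P\<alpha> = P[OF \<alpha>]
    show "linear (mode_apply N \<alpha> (P \<alpha>))"
      by (rule bounded_linear.linear[OF bounded_linear_mode_apply])
    show "norm (mode_apply N \<alpha> (P \<alpha>) x) \<le> norm x" for x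
      unfolding mode_apply_def
      by (meson norm_tensor_of_matrix_le norm_leading_projection_mult_le[OF P\<alpha>] norm_matricization_le order_trans)
    let ?M = "matricization N \<alpha> f"
    have "f - mode_apply N \<alpha> (P \<alpha>) f = tensor_of_matrix N \<alpha> (?M - P \<alpha> ** ?M)"
      by (simp add: mode_apply_def linear_diff[OF linear_tensor_of_matrix] tensor_of_matricization f)
    also have "norm \<dots> \<le> norm (?M - P \<alpha> ** ?M)" by (rule norm_tensor_of_matrix_le)
    also have "\<dots> \<le> ?m * norm (?M - matricization N \<alpha> y)"
      using y \<alpha> by (intro leading_projection_quasi_optimal[OF P\<alpha>]) (simp add: ht_closure_def)
    also have "\<dots> \<le> ?m * norm (f - y)"
      unfolding linear_diff[OF linear_matricization, symmetric]
      by (intro mult_left_mono norm_matricization_le) simp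
    finally show "norm (f - mode_apply N \<alpha> (P \<alpha>) f) \<le> ?m * norm (f - y)" .
  qed
  then show "norm (f - h) \<le> real (length ?xs) * ?m * norm (f - y)" by (simp only: mult.assoc)
qed

lemma constant_le_linear_at_right_0_iff:
  "(\<exists>K\<ge>0. \<forall>\<^sub>F s in at_right 0. norm x \<le> K * s) \<longleftrightarrow> x = 0"
proof
  assume "\<exists>K\<ge>0. \<forall>\<^sub>F s in at_right 0. norm x \<le> K * s"
  then obtain K where "\<forall>\<^sub>F s in at_right 0. norm x \<le> K * s" by blast
  moreover have "((\<lambda>s. K * s) \<longlongrightarrow> K * 0) (at_right 0)"
    by (intro tendsto_intros)
  ultimately have "norm x \<le> K * 0"
    by (intro tendsto_lowerbound) auto
  then show "x = 0" by simp
qed (auto intro!: exI[of _ 0])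

text \<open>
  Any quasi-optimal truncation is second-order accurate along a line exactly in tangent directions.
  If it is, then the truncated points approach \<open>g\<close> with right-sided velocity \<open>v\<close> inside the
  rank-bounded set. Conversely, the truncation is compared with the curve of
  \<open>ht_linearized_second_order_curve\<close>, at distance \<open>s\<^sup>2 * norm (q s)\<close> from the line.
\<close>

lemma second_order_approximation_iff:
  assumes g: "g \<in> ht_manifold N t r" and v: "v \<in> tensors N" and t: "dimension_tree t"
    and T: "\<And>f. f \<in> tensors N \<Longrightarrow> T f \<in> ht_closure N t r"
    and c: "0 \<le> c" "\<And>f y. f \<in> tensors N \<Longrightarrow> y \<in> ht_closure N t r \<Longrightarrow> norm (f - T f) \<le> c * norm (f - y)"
  shows "(\<exists>M\<ge>0. \<forall>\<^sub>F s in at_right 0. norm ((g + s *\<^sub>R v) - T (g + s *\<^sub>R v)) \<le> M * s\<^sup>2)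
    \<longleftrightarrow> v \<in> ht_linearized N t g"
    (is "?approx \<longleftrightarrow> _")
proof -
  have fN: "g + s *\<^sub>R v \<in> tensors N" for s
    using g v by (intro subspace_add[OF subspace_tensors] subspace_scale[OF subspace_tensors])
      (auto simp: ht_manifold_def)
  show ?thesis
  proof
    assume ?approx
    then obtain M where M: "\<forall>\<^sub>F s in at_right 0. norm ((g + s *\<^sub>R v) - T (g + s *\<^sub>R v)) \<le> M * s\<^sup>2" by blast
    show "v \<in> ht_linearized N t g"
    proof (rule velocity_in_ht_linearized[OF g])
      show "\<forall>\<^sub>F s in at_right 0. T (g + s *\<^sub>R v) \<in> ht_closure N t r"
        using T fN by simp
      have "\<forall>\<^sub>F s in at_right 0. norm ((1 / s) *\<^sub>R (T (g + s *\<^sub>R v) - g) - v) \<le> M * s"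
        using M eventually_at_right_less[of 0]
      proof eventually_elim
        case (elim s)
        have "(1 / s) *\<^sub>R (T (g + s *\<^sub>R v) - g) - v = (- 1 / s) *\<^sub>R ((g + s *\<^sub>R v) - T (g + s *\<^sub>R v))"
          using elim by (simp add: algebra_simps)
        also have "norm \<dots> = norm ((g + s *\<^sub>R v) - T (g + s *\<^sub>R v)) / s"
          using elim by simp
        also have "\<dots> \<le> M * s"
          using elim by (simp add: divide_simps power2_eq_square mult_ac)
        finally show ?case .
      qed
      moreover have "((\<lambda>s. M * s) \<longlongrightarrow> 0) (at_right 0)"
        by (rule tendsto_eq_intros refl)+ simp
      ultimately have "((\<lambda>s. (1 / s) *\<^sub>R (T (g + s *\<^sub>R v) - g) - v) \<longlongrightarrow> 0) (at_right 0)"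
        by (rule Lim_null_comparison)
      then show "((\<lambda>s. (1 / s) *\<^sub>R (T (g + s *\<^sub>R v) - g)) \<longlongrightarrow> v) (at_right 0)"
        by (simp only: flip: Lim_null)
    qed
  next
    assume "v \<in> ht_linearized N t g"
    then obtain q \<epsilon> where q: "polynomial_function q" and \<epsilon>: "0 < \<epsilon>"
      and curve: "\<And>s. \<bar>s\<bar> < \<epsilon> \<Longrightarrow> g + s *\<^sub>R v + s\<^sup>2 *\<^sub>R q s \<in> ht_manifold N t r"
      using ht_linearized_second_order_curve[OF g _ t] by blast
    have "((\<lambda>s. norm (q s)) \<longlongrightarrow> norm (q 0)) (at 0)"
      using continuous_polymonial_function[OF q, of 0] by (intro tendsto_norm) (simp add: isCont_def)
    then have "((\<lambda>s. norm (q s)) \<longlongrightarrow> norm (q 0)) (at_right 0)"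
      by (rule tendsto_mono[rotated]) (simp add: at_le)
    then have "\<forall>\<^sub>F s in at_right 0. norm (q s) < norm (q 0) + 1"
      by (rule order_tendstoD) simp
    moreover have "\<forall>\<^sub>F s in at_right 0. s \<in> {0<..<\<epsilon>}"
      using \<epsilon> by (rule eventually_at_right_real)
    ultimately have "\<forall>\<^sub>F s in at_right 0.
        norm ((g + s *\<^sub>R v) - T (g + s *\<^sub>R v)) \<le> c * (norm (q 0) + 1) * s\<^sup>2"
    proof eventually_elim
      case (elim s)
      let ?y = "g + s *\<^sub>R v + s\<^sup>2 *\<^sub>R q s"
      have "?y \<in> ht_closure N t r"
        using curve[of s] elim by (auto simp: ht_manifold_def ht_closure_def)
      then have "norm ((g + s *\<^sub>R v) - T (g + s *\<^sub>R v)) \<le> c * norm (g + s *\<^sub>R v - ?y)"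
        by (rule c(2)[OF fN])
      also have "norm (g + s *\<^sub>R v - ?y) = s\<^sup>2 * norm (q s)" by simp
      also have "c * (s\<^sup>2 * norm (q s)) \<le> c * (s\<^sup>2 * (norm (q 0) + 1))"
        using elim c(1) by (intro mult_left_mono) auto
      finally show ?case by (simp add: mult_ac)
    qed
    then show ?approx
      using c(1) by (intro exI[of _ "c * (norm (q 0) + 1)"]) simp
  qed
qed

theorem proposition3:
  fixes N :: "'d::finite \<Rightarrow> 'n::finite set"
    and t :: "'d dtree"
    and r :: "'d set \<Rightarrow> nat"
    and g v :: "real ^ ('d \<Rightarrow> 'n)"
    and T_best T_svd :: "real ^ ('d \<Rightarrow> 'n) \<Rightarrow> real ^ ('d \<Rightarrow> 'n)"
  assumes "CARD('d) \<ge> 2"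
    and "\<And>\<mu>. N \<mu> \<noteq> {}"
    and "dimension_tree t"
    and "\<And>f. f \<in> tensors N \<Longrightarrow> is_best_truncation N t r f (T_best f)"
    and "\<And>f. f \<in> tensors N \<Longrightarrow> is_svd_truncation N t r f (T_svd f)"
    and "g \<in> ht_manifold N t r"
    and "v \<in> tensors N"
  defines "A \<equiv> \<exists>K\<ge>0. \<forall>\<^sub>F \<Delta>t in at_right 0.
                 norm (v - orth_proj (tangent_space (ht_manifold N t r) g) v) \<le> K * \<Delta>t"
    and "B \<equiv> \<exists>M\<ge>0. \<forall>\<^sub>F \<Delta>t in at_right 0.
                 norm ((g + \<Delta>t *\<^sub>R v) - T_best (g + \<Delta>t *\<^sub>R v)) \<le> M * \<Delta>t\<^sup>2"
    and "C \<equiv> \<exists>C\<ge>0. \<forall>\<^sub>F \<Delta>t in at_right 0.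
                 norm ((g + \<Delta>t *\<^sub>R v) - T_svd (g + \<Delta>t *\<^sub>R v)) \<le> C * \<Delta>t\<^sup>2"
  shows "(A \<longleftrightarrow> B) \<and> (B \<longleftrightarrow> C)"
proof -
  let ?S = "tangent_space (ht_manifold N t r) g"
  have S: "?S = ht_linearized N t g"
    by (rule tangent_space_ht_manifold[OF assms(6,3)])
  have sub: "subspace ?S"
    unfolding S by (rule subspace_ht_linearized)
  have "v - orth_proj ?S v = 0 \<longleftrightarrow> v \<in> ?S"
    using orth_proj_in[OF sub, of v] orth_proj_id[OF sub, of v] by auto
  then have A: "A \<longleftrightarrow> v \<in> ht_linearized N t g"
    unfolding A_def constant_le_linear_at_right_0_iff S .
  have B: "B \<longleftrightarrow> v \<in> ht_linearized N t g"
    unfolding B_def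
  proof (rule second_order_approximation_iff[where c = 1, OF assms(6,7,3)])
    show "T_best f \<in> ht_closure N t r" if "f \<in> tensors N" for f
      using assms(4)[OF that] by (simp add: is_best_truncation_def is_arg_min_linorder)
    show "norm (f - T_best f) \<le> 1 * norm (f - y)" if "f \<in> tensors N" "y \<in> ht_closure N t r" for f y
      using assms(4)[OF that(1)] that(2) by (simp add: is_best_truncation_def is_arg_min_linorder)
  qed simp
  obtain c where c: "0 \<le> c" "\<And>f h y. f \<in> tensors N \<Longrightarrow> is_svd_truncation N t r f h \<Longrightarrow>
      y \<in> ht_closure N t r \<Longrightarrow> norm (f - h) \<le> c * norm (f - y)"
    using svd_truncation_quasi_optimal[OF assms(3)] by blast
  have C: "C \<longleftrightarrow> v \<in> ht_linearized N t g"
    unfolding C_def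
  proof (rule second_order_approximation_iff[OF assms(6,7,3) _ c(1)])
    show "T_svd f \<in> ht_closure N t r" if "f \<in> tensors N" for f
      using assms(6) by (intro svd_truncation_in_closure[OF assms(1,3) _ that assms(5)[OF that]]) auto
    show "norm (f - T_svd f) \<le> c * norm (f - y)" if "f \<in> tensors N" "y \<in> ht_closure N t r" for f y
      by (rule c(2)[OF that(1) assms(5)[OF that(1)] that(2)])
  qed
  show ?thesis using A B C by simp
qed

end
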